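(* Let $S$ and $T$ be disjoint non-empty finite sets. Let $H_0=(S,T;F_0)$ be a simple bipartite graph and $G_0$ its bipartite complement. Let $M_S=(S,r_S)$ and $M_T=(T,r_T)$ be matroids with $r_S(S)=r_T(T)=\ell$, and let $m_V=(m_S,m_T)$ be a degree-specification (non-negative integers) on $S\cup T$ with $\widetilde m_S(S)=\widetilde m_T(T)=\gamma$. Then there exists a bipartite graph $G=(S,T;E)$ fitting $m_V$ for which $G^+=G+H_0$ is simple and includes a matching covering a basis of $M_S$ and a basis of $M_T$ if and only if both $$\widetilde m_S(X)+\widetilde m_T(Y)-d_{G_0}(X,Y)\le\gamma\quad\text{for all } X\subseteq S,\ Y\subseteq T,$$ and $$\widetilde m_S(X)+\widetilde m_T(Y)-d_{G_0}(X,Y)+\ell-r_S(X')-r_T(Y')\le\gamma$$ whenever $X\subseteq X'\subseteq S$, $Y\subseteq Y'\subseteq T$, and $X'\cup Y'$ hits (contains an end-node of) every edge of $H_0$.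
   Context: A bipartite graph $G=(S,T;E)$ has all edges between $S$ and $T$; parallel edges are a priori allowed, and it is simple if it has none. The bipartite complement of a simple bigraph $H_0=(S,T;F_0)$ is $G_0=(S,T;E_0)$ where $E_0$ consists of all pairs $st$ ($s\in S,t\in T$) not in $F_0$; $G+H_0$ denotes the bigraph with edge set $E\cup F_0$. $d_{G_0}(X,Y)$ is the number of edges of $G_0$ joining $X\subseteq S$ and $Y\subseteq T$. $\widetilde m(Z)=\sum_{v\in Z}m(v)$. $G$ fits $m_V$ if $d_G(v)=m_V(v)$ for all $v\in S\cup T$. A matching covers a basis $B$ of a matroid if every element of $B$ is an end-node of an edge of the matching.
   Formalization: The matching covering a basis of M_S and a basis of M_T is required to have exactly ℓ edges, so its end-nodes are precisely the two bases; without this size requirement the "only if" direction fails (e.g. F_0={s1t1,s2t2}, m=0, ℓ=1, with s2 and t1 loops). *)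

theory Defs
  imports Main "HOL-Library.Multiset"
begin

text \<open>
  A bipartite graph with colour classes \<open>S\<close> and \<open>T\<close> is given by the multiset of its edges, the edge
  joining \<open>s \<in> S\<close> and \<open>t \<in> T\<close> being the pair \<open>(s, t)\<close>; multiplicities count parallel edges.
  Accordingly \<open>G + H\<close>, the graph whose edges are those of \<open>G\<close> together with those of \<open>H\<close>, is the
  sum of multisets: an edge of \<open>G\<close> parallel to an edge of \<open>H\<close> makes \<open>G + H\<close> non-simple.
\<close>

type_synonym 'a bigraph = "('a \<times> 'a) multiset"

definition bigraph_on :: "'a set \<Rightarrow> 'a set \<Rightarrow> 'a bigraph \<Rightarrow> bool" where
  "bigraph_on S T G \<longleftrightarrow> finite S \<and> finite T \<and> S \<inter> T = {} \<and> set_mset G \<subseteq> S \<times> T"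

definition simple_bigraph :: "'a bigraph \<Rightarrow> bool" where
  "simple_bigraph G \<longleftrightarrow> (\<forall>e. count G e \<le> 1)"

definition bipartite_complement :: "'a set \<Rightarrow> 'a set \<Rightarrow> 'a bigraph \<Rightarrow> 'a bigraph" where
  "bipartite_complement S T H = mset_set (S \<times> T - set_mset H)"

definition ends :: "'a \<times> 'a \<Rightarrow> 'a set" where
  "ends e = {fst e, snd e}"

definition degree :: "'a bigraph \<Rightarrow> 'a \<Rightarrow> nat" where
  "degree G v = size {#e \<in># G. v \<in> ends e#}"

definition edges_between :: "'a bigraph \<Rightarrow> 'a set \<Rightarrow> 'a set \<Rightarrow> nat" where
  "edges_between G X Y = size {#e \<in># G. fst e \<in> X \<and> snd e \<in> Y#}"

definition fits :: "'a set \<Rightarrow> 'a set \<Rightarrow> 'a bigraph \<Rightarrow> ('a \<Rightarrow> nat) \<Rightarrow> ('a \<Rightarrow> nat) \<Rightarrow> bool" where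
  "fits S T G mS mT \<longleftrightarrow> (\<forall>v\<in>S. degree G v = mS v) \<and> (\<forall>v\<in>T. degree G v = mT v)"

definition hits_every_edge :: "'a set \<Rightarrow> 'a bigraph \<Rightarrow> bool" where
  "hits_every_edge Z G \<longleftrightarrow> (\<forall>e \<in># G. Z \<inter> ends e \<noteq> {})"

definition matching_in :: "'a bigraph \<Rightarrow> ('a \<times> 'a) set \<Rightarrow> bool" where
  "matching_in G N \<longleftrightarrow>
     N \<subseteq> set_mset G \<and> (\<forall>e\<in>N. \<forall>f\<in>N. e \<noteq> f \<longrightarrow> ends e \<inter> ends f = {})"

definition covers :: "('a \<times> 'a) set \<Rightarrow> 'a set \<Rightarrow> bool" where
  "covers N B \<longleftrightarrow> (\<forall>v\<in>B. \<exists>e\<in>N. v \<in> ends e)"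

text \<open>Matroids are given by a ground set and a rank function; values of \<open>r\<close> outside the
  subsets of the ground set are irrelevant.\<close>

definition matroid :: "'a set \<Rightarrow> ('a set \<Rightarrow> nat) \<Rightarrow> bool" where
  "matroid A r \<longleftrightarrow>
     finite A \<and>
     (\<forall>X. X \<subseteq> A \<longrightarrow> r X \<le> card X) \<and>
     (\<forall>X Y. X \<subseteq> Y \<and> Y \<subseteq> A \<longrightarrow> r X \<le> r Y) \<and>
     (\<forall>X Y. X \<subseteq> A \<and> Y \<subseteq> A \<longrightarrow> r (X \<union> Y) + r (X \<inter> Y) \<le> r X + r Y)"

definition matroid_indep :: "'a set \<Rightarrow> ('a set \<Rightarrow> nat) \<Rightarrow> 'a set \<Rightarrow> bool" where
  "matroid_indep A r I \<longleftrightarrow> I \<subseteq> A \<and> r I = card I"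

definition matroid_basis :: "'a set \<Rightarrow> ('a set \<Rightarrow> nat) \<Rightarrow> 'a set \<Rightarrow> bool" where
  "matroid_basis A r B \<longleftrightarrow>
     matroid_indep A r B \<and> (\<forall>I. matroid_indep A r I \<and> B \<subseteq> I \<longrightarrow> I = B)"

text \<open>
  For matroids of common rank \<open>l\<close> on the two colour classes, a matching covering a basis of each
  is understood as in Brualdi's matroidal version of Koenig's theorem: it consists of \<open>l\<close> edges, so
  that its end-nodes form exactly the two bases. Without the size requirement two different parts
  of a larger matching could cover the two bases, and the min-max theorems fail: take
  \<open>H = {#(s1,t1), (s2,t2)#}\<close>, degree specification \<open>0\<close>, \<open>l = 1\<close>, and matroids in which exactly
  \<open>s2\<close> and \<open>t1\<close> are loops.
\<close>

definition has_basis_matching ::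
  "'a bigraph \<Rightarrow> 'a set \<Rightarrow> ('a set \<Rightarrow> nat) \<Rightarrow> 'a set \<Rightarrow> ('a set \<Rightarrow> nat) \<Rightarrow> nat \<Rightarrow> bool" where
  "has_basis_matching G S rS T rT l \<longleftrightarrow>
     (\<exists>N BS BT. matching_in G N \<and> card N = l \<and>
        matroid_basis S rS BS \<and> covers N BS \<and>
        matroid_basis T rT BT \<and> covers N BT)"

end

theory Submission
  imports Defs
begin

text \<open>
  Necessity is a count of the edges of \<open>G\<close> that meet or avoid \<open>X \<union> Y\<close>. For sufficiency, a set
  \<open>Z \<subseteq> S \<union> T\<close> stands for the rectangle \<open>(S \<inter> Z) \<times> (T - Z)\<close> of edges leaving it, and everything
  required of \<open>G\<close> (degrees, simplicity, avoiding \<open>H0\<close>, and the covering condition equivalent to a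
  basis matching) becomes a lower bound \<open>p Z\<close> on the number of edges leaving \<open>Z\<close>, subject to \<open>G\<close>
  having only \<open>\<gamma>\<close> edges. The function \<open>p\<close> is supermodular on crossing pairs because a rectangle
  constrained by the ranks contains no edge of \<open>H0\<close>. By the theorem of Frank and Jordan it
  can be covered by \<open>\<gamma>\<close> edges unless pairwise disjoint rectangles demand more than \<open>\<gamma>\<close> in total; such
  rectangles merge into rows, columns and a single rank rectangle, and then violate one
  of the two inequalities.
\<close>

section \<open>Covering crossing supermodular functions\<close>

text \<open>Coding rectangles by sets of nodes turns their uncrossing into plain set operations: for
  rectangles \<open>A \<times> B\<close> and \<open>A' \<times> B'\<close>, intersection of the sets
  gives \<open>(A \<inter> A') \<times> (B \<union> B')\<close> and union gives
  \<open>(A \<union> A') \<times> (B \<inter> B')\<close>. The demands arise as follows. If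
  \<open>S \<inter> Z = {s}\<close>, simplicity allows \<open>s\<close> at most one edge to each
  node of \<open>T \<inter> Z\<close> that is not its neighbour in \<open>H0\<close>, and none to
  the others; the rest of its degree must leave \<open>Z\<close>. For the ranks, let
  \<open>X' \<union> Y'\<close> hit every edge of \<open>H0\<close>. Adding one end of each missed
  edge of \<open>G\<close> yields a cover of \<open>G + H0\<close> and raises the rank sum by at
  most one per edge. So Koenig's condition for \<open>G + H0\<close> amounts to \<open>G\<close>
  having at least \<open>l - rS X' - rT Y'\<close> edges that avoid \<open>X' \<union> Y'\<close>,
  for all covers of \<open>H0\<close> alone. The nested pairs in the second inequality are a normal
  form: rows \<open>X\<close>, columns \<open>Y\<close> and a rank rectangle
  \<open>(S - X') \<times> (T - Y')\<close> that shares no row or column with them.\<close>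

definition leaves :: "'a \<times> 'a \<Rightarrow> 'a set \<Rightarrow> bool" where
  "leaves e Z \<longleftrightarrow> fst e \<in> Z \<and> snd e \<notin> Z"

text \<open>Equivalently, some pair of \<open>S \<times> T\<close> leaves both sets: the two
  rectangles intersect.\<close>

definition crossing :: "'a set \<Rightarrow> 'a set \<Rightarrow> 'a set \<Rightarrow> 'a set \<Rightarrow> bool" where
  "crossing S T Z W \<longleftrightarrow> S \<inter> (Z \<inter> W) \<noteq> {} \<and> \<not> T \<subseteq> Z \<union> W"

definition independent :: "'a set \<Rightarrow> 'a set \<Rightarrow> 'a set set \<Rightarrow> bool" where
  "independent S T I \<longleftrightarrow> pairwise (\<lambda>Z W. \<not> crossing S T Z W) I"

definition cross_free :: "'a set \<Rightarrow> 'a set \<Rightarrow> 'a set multiset \<Rightarrow> bool" where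
  "cross_free S T M \<longleftrightarrow> (\<forall>Z\<in>#M. \<forall>W\<in>#M. crossing S T Z W \<longrightarrow> Z \<subseteq> W \<or> W \<subseteq> Z)"

definition crossing_supermodular ::
    "'a set \<Rightarrow> 'a set \<Rightarrow> 'a set set \<Rightarrow> ('a set \<Rightarrow> int) \<Rightarrow> bool" where
  "crossing_supermodular S T F p \<longleftrightarrow>
     (\<forall>Z\<in>F. \<forall>W\<in>F. crossing S T Z W \<longrightarrow>
        Z \<inter> W \<in> F \<and> Z \<union> W \<in> F \<and> p Z + p W \<le> p (Z \<inter> W) + p (Z \<union> W))"

lemma crossing_commute: "crossing S T Z W \<longleftrightarrow> crossing S T W Z"
  by (auto simp: crossing_def)

lemma independent_unique:
  assumes "independent S T I" "Z \<in> I" "W \<in> I" "leaves e Z" "leaves e W" "e \<in> S \<times> T"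
  shows "Z = W"
proof (rule ccontr)
  assume "Z \<noteq> W"
  then have "\<not> crossing S T Z W"
    using assms unfolding independent_def pairwise_def by blast
  then show False
    using assms(4-6) by (auto simp: crossing_def leaves_def)
qed

text \<open>The gain is \<open>2 * card (Z - W) * card (W - Z)\<close>, positive for incomparable
  sets. This is the potential that makes uncrossing terminate.\<close>

lemma card_squares_uncross:
  assumes "finite Z" "finite W" "\<not> Z \<subseteq> W" "\<not> W \<subseteq> Z"
  shows "(card Z)\<^sup>2 + (card W)\<^sup>2 < (card (Z \<inter> W))\<^sup>2 + (card (Z \<union> W))\<^sup>2"
proof -
  define a b c where "a = card (Z - W)" and "b = card (W - Z)" and "c = card (Z \<inter> W)"
  have pos: "a > 0" "b > 0"
    using assms by (auto simp: a_def b_def card_gt_0_iff)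
  have Z: "card Z = a + c"
    using card_Int_Diff[OF assms(1), of W] by (simp add: a_def c_def)
  have W: "card W = b + c"
    using card_Int_Diff[OF assms(2), of Z] by (simp add: b_def c_def Int_commute)
  have U: "card (Z \<union> W) = a + b + c"
    using card_Un_Int[OF assms(1,2)] Z W by (simp add: c_def)
  have "c * c + (a + b + c) * (a + b + c) =
      (a + c) * (a + c) + (b + c) * (b + c) + 2 * (a * b)"
    by (simp add: algebra_simps)
  moreover have "a * b > 0"
    using pos by simp
  ultimately show ?thesis
    unfolding Z W U by (simp add: power2_eq_square c_def[symmetric])
qed

text \<open>Replacing a crossing incomparable pair by its intersection and union keeps the number of
  members, does not lower the sum of \<open>p\<close>, and lets no edge leave more members than
  before. It raises the sum of squared cardinalities, which cannot exceed
  \<open>size M * (card (S \<union> T))\<^sup>2\<close>; the gap between the two is the induction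
  measure.\<close>

lemma uncross_multiset:
  assumes fin: "finite (S \<union> T)" and F: "F \<subseteq> Pow (S \<union> T)"
    and csm: "crossing_supermodular S T F p" and "set_mset M \<subseteq> F"
  shows "\<exists>M'. set_mset M' \<subseteq> F \<and> cross_free S T M' \<and>
           (\<Sum>Z\<in>#M. p Z) \<le> (\<Sum>Z\<in>#M'. p Z) \<and>
           (\<forall>e. size {#Z \<in># M'. leaves e Z#} \<le> size {#Z \<in># M. leaves e Z#})"
  using assms(4)
proof (induction "size M * (card (S \<union> T))\<^sup>2 - (\<Sum>Z\<in>#M. (card Z)\<^sup>2)" arbitrary: M rule: less_induct)
  case less
  show ?case
  proof (cases "cross_free S T M")
    case True
    then show ?thesis using less.prems by blast
  next
    case False
    then obtain Z W where ZW: "Z \<in># M" "W \<in># M" "crossing S T Z W" "\<not> Z \<subseteq> W" "\<not> W \<subseteq> Z"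
      by (auto simp: cross_free_def)
    obtain M0 where M0: "M = add_mset Z M0"
      using multi_member_split[OF ZW(1)] by blast
    have "W \<in># M0"
      using ZW(2,5) M0 by auto
    then obtain R where M: "M = add_mset Z (add_mset W R)"
      using multi_member_split[of W M0] M0 by blast
    define M1 where "M1 = add_mset (Z \<inter> W) (add_mset (Z \<union> W) R)"
    have ZWF: "Z \<in> F" "W \<in> F"
      using ZW less.prems by auto
    have un: "Z \<inter> W \<in> F" "Z \<union> W \<in> F" "p Z + p W \<le> p (Z \<inter> W) + p (Z \<union> W)"
      using csm ZWF ZW(3) by (auto simp: crossing_supermodular_def)
    have M1F: "set_mset M1 \<subseteq> F"
      using less.prems un by (auto simp: M1_def M)
    have "finite Z" "finite W"
      using ZWF F fin by (auto intro: finite_subset)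
    then have lt: "(\<Sum>Z\<in>#M. (card Z)\<^sup>2) < (\<Sum>Z\<in>#M1. (card Z)\<^sup>2)"
      using card_squares_uncross[of Z W] ZW by (simp add: M M1_def)
    have "(card Z)\<^sup>2 \<le> (card (S \<union> T))\<^sup>2" if "Z \<in># M1" for Z
      using that M1F F fin by (intro power_mono card_mono) auto
    then have "(\<Sum>Z\<in>#M1. (card Z)\<^sup>2) \<le> (\<Sum>Z\<in>#M1. (card (S \<union> T))\<^sup>2)"
      by (rule sum_mset_mono)
    then have "(\<Sum>Z\<in>#M1. (card Z)\<^sup>2) \<le> size M1 * (card (S \<union> T))\<^sup>2"
      by simp
    moreover have "size M1 = size M"
      by (simp add: M M1_def)
    ultimately have "size M1 * (card (S \<union> T))\<^sup>2 - (\<Sum>Z\<in>#M1. (card Z)\<^sup>2) <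
        size M * (card (S \<union> T))\<^sup>2 - (\<Sum>Z\<in>#M. (card Z)\<^sup>2)"
      using lt by simp
    from less.hyps[OF this M1F] obtain M' where M': "set_mset M' \<subseteq> F" "cross_free S T M'"
        "(\<Sum>Z\<in>#M1. p Z) \<le> (\<Sum>Z\<in>#M'. p Z)"
        "\<And>e. size {#Z \<in># M'. leaves e Z#} \<le> size {#Z \<in># M1. leaves e Z#}"
      by blast
    have "(\<Sum>Z\<in>#M. p Z) \<le> (\<Sum>Z\<in>#M1. p Z)"
      using un(3) by (simp add: M M1_def)
    moreover have "size {#Z \<in># M1. leaves e Z#} \<le> size {#Z \<in># M. leaves e Z#}" for e
      unfolding M M1_def
      by (cases "fst e \<in> Z"; cases "fst e \<in> W"; cases "snd e \<in> Z"; cases "snd e \<in> W")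
        (simp_all add: leaves_def)
    ultimately show ?thesis
      using M' by (meson order_trans)
  qed
qed

text \<open>The minimal members of a cross-free family form an independent family, and removing them
  lowers the maximum number of members left by an edge.\<close>

lemma cross_free_sum_le:
  assumes F: "\<And>Z. Z \<in> F \<Longrightarrow> S \<inter> Z \<noteq> {} \<and> \<not> T \<subseteq> Z"
    and bound: "\<And>I. I \<subseteq> F \<Longrightarrow> finite I \<Longrightarrow> independent S T I \<Longrightarrow> sum p I \<le> (c::int)"
    and "set_mset M \<subseteq> F" "cross_free S T M"
    and "\<And>e. e \<in> S \<times> T \<Longrightarrow> size {#Z \<in># M. leaves e Z#} \<le> k"
  shows "(\<Sum>Z\<in>#M. p Z) \<le> int k * c"
  using assms(3-)
proof (induction k arbitrary: M)
  case 0
  have "M = {#}"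
  proof (rule ccontr)
    assume "M \<noteq> {#}"
    then obtain Z where Z: "Z \<in># M"
      by blast
    then obtain s t where "s \<in> S" "s \<in> Z" "t \<in> T" "t \<notin> Z"
      using F 0(1) by blast
    then have "Z \<in># {#Z \<in># M. leaves (s, t) Z#}"
      using Z by (simp add: leaves_def)
    moreover have "size {#Z \<in># M. leaves (s, t) Z#} \<le> 0"
      using 0(3) \<open>s \<in> S\<close> \<open>t \<in> T\<close> by blast
    ultimately show False
      by (metis empty_iff le_zero_eq set_mset_empty size_eq_0_iff_empty)
  qed
  then show ?case by simp
next
  case (Suc k)
  define I where "I = {Z \<in> set_mset M. \<forall>W\<in>#M. \<not> W \<subset> Z}"
  have I: "I \<subseteq> set_mset M" "finite I"
    by (auto simp: I_def)
  have "independent S T I"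
    unfolding independent_def pairwise_def
  proof (intro ballI impI notI)
    fix Z W assume "Z \<in> I" "W \<in> I" "Z \<noteq> W" "crossing S T Z W"
    moreover from this have "Z \<subseteq> W \<or> W \<subseteq> Z"
      using Suc.prems(2) I(1) unfolding cross_free_def by blast
    ultimately show False
      by (auto simp: I_def)
  qed
  then have "sum p I \<le> c"
    using bound I Suc.prems(1) by blast
  \<comment> \<open>Only one copy of each minimal member is removed; repeated copies stay for later
    rounds.\<close>
  define M1 where "M1 = M - mset_set I"
  have sub: "mset_set I \<subseteq># M"
    using subset_imp_msubset_mset_set[OF I(1)] mset_set_set_mset_msubset[of M]
    by (meson finite_set_mset subset_mset.order_trans)
  have M: "M = mset_set I + M1"
    using sub by (simp add: M1_def)
  have "size {#Z \<in># M1. leaves e Z#} \<le> k" if e: "e \<in> S \<times> T" for e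
  proof (rule ccontr)
    assume "\<not> size {#Z \<in># M1. leaves e Z#} \<le> k"
    moreover have size_M: "size {#Z \<in># M. leaves e Z#} =
        size {#Z \<in># mset_set I. leaves e Z#} + size {#Z \<in># M1. leaves e Z#}"
      by (subst M) simp
    moreover have "size {#Z \<in># M. leaves e Z#} \<le> Suc k"
      using Suc.prems(3) e by blast
    ultimately have "size {#Z \<in># mset_set I. leaves e Z#} = 0"
      and full: "size {#Z \<in># M. leaves e Z#} = Suc k"
      by linarith+
    then have nI: "\<not> leaves e Z" if "Z \<in> I" for Z
      using that I(2) by auto
    define C where "C = {Z \<in> set_mset M. leaves e Z}"
    have "C \<noteq> {}"
    proof
      assume "C = {}"
      then have "{#Z \<in># M. leaves e Z#} = {#}"
        by (auto simp: C_def)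
      with full show False by simp
    qed
    moreover have "finite C"
      by (simp add: C_def)
    ultimately obtain Z1 where Z1: "Z1 \<in> C" "\<And>W. W \<in> C \<Longrightarrow> \<not> W \<subset> Z1"
      using finite_has_minimal[of C] by blast
    have chain: "Z1 \<subseteq> W" if "W \<in> C" for W
    proof -
      have "crossing S T Z1 W"
        using e that Z1(1) by (auto simp: crossing_def C_def leaves_def)
      then have "Z1 \<subseteq> W \<or> W \<subseteq> Z1"
        using Suc.prems(2) that Z1(1) by (auto simp: cross_free_def C_def)
      then show ?thesis
        using Z1(2)[OF that] by blast
    qed
    have "Z1 \<notin> I"
      using nI Z1(1) by (auto simp: C_def)
    then obtain W where W: "W \<in># M" "W \<subset> Z1"
      using Z1(1) by (auto simp: I_def C_def)
    obtain s0 where s0: "s0 \<in> S" "s0 \<in> W"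
      using F W(1) Suc.prems(1) by blast
    have WC: "\<not> leaves e W"
      using Z1(2) W by (auto simp: C_def)
    \<comment> \<open>Moving the tail of \<open>e\<close> into \<open>W\<close> keeps every member
      that \<open>e\<close> leaves, since all of them contain \<open>Z1\<close> and hence
      \<open>W\<close>, and it adds \<open>W\<close> itself. The moved edge would leave more than
      \<open>Suc k\<close> members.\<close>
    have "{#Z \<in># M. leaves e Z \<or> Z = W#} \<subseteq># {#Z \<in># M. leaves (s0, snd e) Z#}"
    proof (rule filter_mset_mono_strong)
      fix Z assume "Z \<in># M" "leaves e Z \<or> Z = W"
      then show "leaves (s0, snd e) Z"
        using chain[of Z] W s0 Z1(1) by (auto simp: C_def leaves_def)
    qed simp
    then have "size {#Z \<in># M. leaves e Z \<or> Z = W#} \<le> size {#Z \<in># M. leaves (s0, snd e) Z#}"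
      by (rule size_mset_mono)
    also have "\<dots> \<le> Suc k"
      using Suc.prems(3) e s0 by (auto simp: mem_Times_iff)
    finally have "size {#Z \<in># M. leaves e Z \<or> Z = W#} \<le> Suc k" .
    moreover have "{#Z \<in># M. leaves e Z \<or> Z = W#} =
        {#Z \<in># M. leaves e Z#} + {#Z \<in># M. Z = W#}"
      using WC by (auto simp: multiset_eq_iff)
    then have "size {#Z \<in># M. leaves e Z \<or> Z = W#} =
        size {#Z \<in># M. leaves e Z#} + size {#Z \<in># M. Z = W#}"
      by (metis size_union)
    moreover have "size {#Z \<in># M. Z = W#} > 0"
      using W(1) by (simp add: count_conv_size_mset[symmetric])
    ultimately show False
      using full by linarith
  qed
  moreover have "set_mset M1 \<subseteq> F" "cross_free S T M1"
    using Suc.prems(1,2) in_diffD[of _ M "mset_set I"] by (auto simp: M1_def cross_free_def)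
  ultimately have "(\<Sum>Z\<in>#M1. p Z) \<le> int k * c"
    using Suc.IH by blast
  moreover have "(\<Sum>Z\<in>#M. p Z) = sum p I + (\<Sum>Z\<in>#M1. p Z)"
    by (subst M) (simp add: sum_unfold_sum_mset)
  ultimately show ?case
    using \<open>sum p I \<le> c\<close> by (simp add: algebra_simps)
qed

lemma sum_mset_sum:
  assumes "finite A"
  shows "(\<Sum>Z\<in>#(\<Sum>e\<in>A. N e). f Z) = (\<Sum>e\<in>A. \<Sum>Z\<in>#N e. (f Z :: int))"
  using assms by (induction A) auto

lemma size_filter_sum:
  assumes "finite A"
  shows "size {#Z \<in># (\<Sum>e\<in>A. N e). P Z#} = (\<Sum>e\<in>A. size {#Z \<in># N e. P Z#})"
  using assms by (induction A) auto

text \<open>If every edge missed some optimal independent family, the sum of those families would,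
  after uncrossing, decompose into fewer independent families than it was built from.\<close>

lemma exists_edge_meeting_optimal:
  assumes fin: "finite S" "finite T" and F: "F \<subseteq> Pow (S \<union> T)"
    and ne: "\<And>Z. Z \<in> F \<Longrightarrow> S \<inter> Z \<noteq> {} \<and> \<not> T \<subseteq> Z"
    and csm: "crossing_supermodular S T F p"
    and bound: "\<And>I. I \<subseteq> F \<Longrightarrow> finite I \<Longrightarrow> independent S T I \<Longrightarrow> sum p I \<le> int (Suc k)"
    and "S \<noteq> {}" "T \<noteq> {}"
  shows "\<exists>e\<in>S \<times> T. \<forall>I. I \<subseteq> F \<and> finite I \<and> independent S T I \<longrightarrow>
           (\<Sum>Z\<in>I. p Z - of_bool (leaves e Z)) \<le> int k"
proof (rule ccontr)
  assume "\<not> ?thesis"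
  then have "\<forall>e\<in>S \<times> T. \<exists>I. I \<subseteq> F \<and> finite I \<and> independent S T I \<and>
      int k < (\<Sum>Z\<in>I. p Z - of_bool (leaves e Z))"
    by (meson not_le)
  then obtain J where J: "\<And>e. e \<in> S \<times> T \<Longrightarrow> J e \<subseteq> F \<and> finite (J e) \<and> independent S T (J e) \<and>
      int k < (\<Sum>Z\<in>J e. p Z - of_bool (leaves e Z))"
    by metis
  define E where "E = S \<times> T"
  have E: "finite E" "E \<noteq> {}"
    using assms by (auto simp: E_def)
  have opt: "sum p (J e) = int (Suc k)" and miss: "\<And>Z. Z \<in> J e \<Longrightarrow> \<not> leaves e Z"
    if "e \<in> E" for e
  proof -
    have Je: "J e \<subseteq> F" "finite (J e)" "independent S T (J e)"
      "int k < (\<Sum>Z\<in>J e. p Z - of_bool (leaves e Z))"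
      using J that by (auto simp: E_def)
    \<comment> \<open>There is no integer strictly between \<open>k\<close> and
      \<open>Suc k\<close>, so a family that stays above \<open>k\<close> is optimal and has no
      member left by \<open>e\<close>.\<close>
    have "int k + (\<Sum>Z\<in>J e. of_bool (leaves e Z)) < sum p (J e)"
      using Je(4) by (simp add: sum_subtractf)
    moreover have "sum p (J e) \<le> int (Suc k)"
      using bound Je by blast
    moreover have nonneg: "(\<Sum>Z\<in>J e. of_bool (leaves e Z) :: int) \<ge> 0"
      by (simp add: sum_nonneg)
    ultimately have "sum p (J e) = int (Suc k)" "(\<Sum>Z\<in>J e. of_bool (leaves e Z) :: int) = 0"
      by linarith+
    then show "sum p (J e) = int (Suc k)" "\<And>Z. Z \<in> J e \<Longrightarrow> \<not> leaves e Z"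
      using Je(2) by (auto simp: sum_nonneg_eq_0_iff simp del: sum_of_bool_eq)
  qed
  define M where "M = (\<Sum>e\<in>E. mset_set (J e))"
  have fJ: "finite (J e)" "J e \<subseteq> F" "independent S T (J e)" if "e \<in> E" for e
    using J that by (auto simp: E_def)
  have "set_mset M \<subseteq> F"
  proof
    fix Z assume "Z \<in># M"
    then obtain e where "e \<in> E" "Z \<in> J e"
      using fJ(1) E(1) by (force simp: M_def set_mset_sum)
    then show "Z \<in> F"
      using fJ(2) by blast
  qed
  then obtain M' where M': "set_mset M' \<subseteq> F" "cross_free S T M'"
      "(\<Sum>Z\<in>#M. p Z) \<le> (\<Sum>Z\<in>#M'. p Z)"
      "\<And>e. size {#Z \<in># M'. leaves e Z#} \<le> size {#Z \<in># M. leaves e Z#}"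
    using uncross_multiset[OF finite_UnI[OF fin] F csm, of M] by blast
  \<comment> \<open>Each independent family has at most one member left by \<open>f\<close>, and
    \<open>J f\<close> has none. This single saving is the contradiction: the families sum to
    \<open>card E * Suc k\<close>, while at most \<open>(card E - 1) * Suc k\<close> is
    possible.\<close>
  have "size {#Z \<in># M. leaves f Z#} \<le> card E - 1" if f: "f \<in> E" for f
  proof -
    have "size {#Z \<in># mset_set (J e). leaves f Z#} \<le> of_bool (e \<noteq> f)" if e: "e \<in> E" for e
    proof -
      let ?L = "{Z \<in> J e. leaves f Z}"
      have "Z = W" if "Z \<in> ?L" "W \<in> ?L" for Z W
        using independent_unique[OF fJ(3)[OF e]] that f by (auto simp: E_def)
      then have "card ?L \<le> 1"
        using fJ(1)[OF e] by (simp add: card_le_Suc0_iff_eq)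
      moreover have "?L = {}" if "e = f"
        using miss[OF e] that by blast
      ultimately show ?thesis
        using fJ(1)[OF e] by (cases "e = f") auto
    qed
    then have "size {#Z \<in># M. leaves f Z#} \<le> (\<Sum>e\<in>E. of_bool (e \<noteq> f))"
      unfolding M_def size_filter_sum[OF E(1)] by (rule sum_mono)
    also have "\<dots> = card E - 1"
    proof -
      have "E \<inter> {e. e \<noteq> f} = E - {f}" by auto
      then show ?thesis using E(1) f by simp
    qed
    finally show ?thesis .
  qed
  then have "\<And>f. f \<in> S \<times> T \<Longrightarrow> size {#Z \<in># M'. leaves f Z#} \<le> card E - 1"
    using M'(4) le_trans unfolding E_def by blast
  then have "(\<Sum>Z\<in>#M'. p Z) \<le> int (card E - 1) * int (Suc k)"
    using cross_free_sum_le[OF ne bound M'(1,2)] by blast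
  moreover have "(\<Sum>Z\<in>#M. p Z) = int (card E) * int (Suc k)"
  proof -
    have "(\<Sum>Z\<in>#M. p Z) = (\<Sum>e\<in>E. sum p (J e))"
      unfolding M_def sum_mset_sum[OF E(1)] by (simp add: sum_unfold_sum_mset)
    then show ?thesis using opt by simp
  qed
  moreover have "card E > 0"
    using E by (simp add: card_gt_0_iff)
  ultimately show False
    using M'(3) by (simp add: of_nat_diff algebra_simps)
qed

text \<open>Edges are chosen greedily. The edge supplied by
  \<open>exists_edge_meeting_optimal\<close> lowers the bound for all independent families by one,
  and subtracting its leaving indicator preserves crossing supermodularity because that indicator is
  submodular.\<close>

theorem crossing_supermodular_cover:
  assumes fin: "finite S" "finite T" and F: "F \<subseteq> Pow (S \<union> T)"
    and ne: "\<And>Z. Z \<in> F \<Longrightarrow> S \<inter> Z \<noteq> {} \<and> \<not> T \<subseteq> Z"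
    and csm: "crossing_supermodular S T F p"
    and bound: "\<And>I. I \<subseteq> F \<Longrightarrow> finite I \<Longrightarrow> independent S T I \<Longrightarrow> sum p I \<le> int k"
  shows "\<exists>E. set_mset E \<subseteq> S \<times> T \<and> size E \<le> k \<and>
           (\<forall>Z\<in>F. p Z \<le> int (size {#e \<in># E. leaves e Z#}))"
  using csm bound
proof (induction k arbitrary: p)
  case 0
  have "p Z \<le> 0" if "Z \<in> F" for Z
    using 0(2)[of "{Z}"] that by (simp add: independent_def)
  then show ?case
    by (intro exI[of _ "{#}"]) auto
next
  case (Suc k)
  show ?case
  proof (cases "S = {} \<or> T = {}")
    case True
    then have "F = {}"
      using ne by blast
    then show ?thesis
      by (intro exI[of _ "{#}"]) auto
  next
    case False
    then obtain e where e: "e \<in> S \<times> T"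
      "\<And>I. I \<subseteq> F \<Longrightarrow> finite I \<Longrightarrow> independent S T I \<Longrightarrow>
         (\<Sum>Z\<in>I. p Z - of_bool (leaves e Z)) \<le> int k"
      using exists_edge_meeting_optimal[OF fin F ne Suc.prems] by blast
    have le: "(of_bool (leaves e (Z \<inter> W)) + of_bool (leaves e (Z \<union> W)) :: int) \<le>
        of_bool (leaves e Z) + of_bool (leaves e W)" for Z W
      by (auto simp: leaves_def)
    have "crossing_supermodular S T F (\<lambda>Z. p Z - of_bool (leaves e Z))"
      unfolding crossing_supermodular_def
    proof (intro ballI impI conjI)
      fix Z W assume "Z \<in> F" "W \<in> F" "crossing S T Z W"
      then have "Z \<inter> W \<in> F \<and> Z \<union> W \<in> F \<and> p Z + p W \<le> p (Z \<inter> W) + p (Z \<union> W)"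
        using Suc.prems(1) by (simp add: crossing_supermodular_def)
      then show "Z \<inter> W \<in> F" "Z \<union> W \<in> F"
        "p Z - of_bool (leaves e Z) + (p W - of_bool (leaves e W)) \<le>
         p (Z \<inter> W) - of_bool (leaves e (Z \<inter> W)) + (p (Z \<union> W) - of_bool (leaves e (Z \<union> W)))"
        using le[of Z W] by auto
    qed
    from Suc.IH[OF this e(2)] obtain E where E: "set_mset E \<subseteq> S \<times> T" "size E \<le> k"
      "\<And>Z. Z \<in> F \<Longrightarrow> p Z - of_bool (leaves e Z) \<le> int (size {#e \<in># E. leaves e Z#})"
      by blast
    have "p Z \<le> int (size {#e \<in># add_mset e E. leaves e Z#})" if "Z \<in> F" for Z
      using E(3)[OF that] by (auto split: if_splits)
    then show ?thesis
      using E e(1) by (intro exI[of _ "add_mset e E"]) auto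
  qed
qed

section \<open>Matroids and matchings\<close>

lemma matroid_mono: "matroid A r \<Longrightarrow> X \<subseteq> Y \<Longrightarrow> Y \<subseteq> A \<Longrightarrow> r X \<le> r Y"
  by (simp add: matroid_def)

lemma matroid_submod:
  "matroid A r \<Longrightarrow> X \<subseteq> A \<Longrightarrow> Y \<subseteq> A \<Longrightarrow> r (X \<union> Y) + r (X \<inter> Y) \<le> r X + r Y"
  by (simp add: matroid_def)

lemma matroid_rank_le_card: "matroid A r \<Longrightarrow> X \<subseteq> A \<Longrightarrow> r X \<le> card X"
  by (simp add: matroid_def)

text \<open>The contracted element stays in the ground set as a loop, so \<open>A\<close> does not
  change during the induction. The truncated subtraction is exact because every set containing
  \<open>x\<close> has rank at least 1.\<close>

lemma matroid_contract:
  assumes "matroid A r" "x \<in> A" "r {x} = 1"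
  shows "matroid A (\<lambda>X. r (insert x X) - 1)"
proof -
  have ge: "1 \<le> r (insert x X)" if "X \<subseteq> A" for X
    using matroid_mono[OF assms(1), of "{x}" "insert x X"] assms(2,3) that by simp
  have sub: "r (X \<union> Y) + r (X \<inter> Y) \<le> r X + r Y" if "X \<subseteq> A" "Y \<subseteq> A" for X Y
    using matroid_submod[OF assms(1) that] .
  have "r (insert x X) - 1 \<le> card X" if X: "X \<subseteq> A" for X
  proof -
    have "r (insert x X) \<le> r X + r {x}"
      using sub[of X "{x}"] X assms(2) by (simp add: Un_commute)
    moreover have "r X \<le> card X"
      using assms(1) X by (auto simp: matroid_def)
    ultimately show ?thesis using assms(3) by linarith
  qed
  moreover have "r (insert x X) - 1 \<le> r (insert x Y) - 1" if "X \<subseteq> Y" "Y \<subseteq> A" for X Y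
  proof -
    have "insert x X \<subseteq> insert x Y" "insert x Y \<subseteq> A"
      using that assms(2) by auto
    then show ?thesis
      by (intro diff_le_mono matroid_mono[OF assms(1)])
  qed
  moreover have "r (insert x (X \<union> Y)) - 1 + (r (insert x (X \<inter> Y)) - 1)
      \<le> r (insert x X) - 1 + (r (insert x Y) - 1)" if "X \<subseteq> A" "Y \<subseteq> A" for X Y
  proof -
    have "X \<union> Y \<subseteq> A" "X \<inter> Y \<subseteq> A" using that by auto
    then show ?thesis
      using sub[of "insert x X" "insert x Y"] that assms(2) ge[of X] ge[of Y] ge[of "X \<union> Y"]
        ge[of "X \<inter> Y"] by (simp add: insert_is_Un[symmetric])
  qed
  ultimately show ?thesis
    using assms(1) by (simp add: matroid_def)
qed

lemma matroid_rank_Un_le_card: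
  assumes "matroid A r" "X \<subseteq> A" "Y \<subseteq> A"
  shows "r (X \<union> Y) \<le> r X + card Y"
proof -
  have "r (X \<union> Y) + r (X \<inter> Y) \<le> r X + r Y" "r Y \<le> card Y"
    using assms by (auto simp: matroid_def)
  then show ?thesis by linarith
qed

lemma matroid_indep_subset:
  assumes "matroid A r" "matroid_indep A r I" "J \<subseteq> I"
  shows "r J = card J"
proof -
  have fin: "finite I"
    using assms by (auto simp: matroid_def matroid_indep_def intro: finite_subset)
  have "r I \<le> r J + card (I - J)"
    using matroid_rank_Un_le_card[OF assms(1), of J "I - J"] assms
    by (auto simp: matroid_indep_def Un_absorb1)
  moreover have "card I = card J + card (I - J)"
    using fin assms(3) by (metis card_mono finite_subset card_Diff_subset le_add_diff_inverse)
  moreover have "r J \<le> card J" "r I = card I"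
    using assms by (auto simp: matroid_def matroid_indep_def)
  ultimately show ?thesis by linarith
qed

text \<open>Maximality under inclusion only says that no single element raises the rank of
  \<open>B\<close>. Submodularity extends this to sets, one element at a time, up to all of
  \<open>A\<close>.\<close>

lemma matroid_basis_card:
  assumes "matroid A r" "matroid_basis A r B"
  shows "card B = r A"
proof -
  have B: "B \<subseteq> A" "r B = card B"
    using assms by (auto simp: matroid_basis_def matroid_indep_def)
  have finA: "finite A"
    using assms by (simp add: matroid_def)
  have finB: "finite B"
    using B finA finite_subset by blast
  have stuck: "r (insert x B) \<le> r B" if "x \<in> A" for x
  proof (cases "x \<in> B")
    case False
    have "r (insert x B) \<le> card (insert x B)"
      using matroid_rank_le_card[OF assms(1)] that B(1) by simp
    moreover have "r (insert x B) \<noteq> card (insert x B)"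
    proof
      assume "r (insert x B) = card (insert x B)"
      then have "insert x B = B"
        using assms(2) that B(1) by (simp add: matroid_basis_def matroid_indep_def subset_insertI)
      with False show False by blast
    qed
    ultimately show ?thesis
      using False finB B by simp
  qed (simp add: insert_absorb)
  have "r (B \<union> C) \<le> r B" if "C \<subseteq> A" "finite C" for C
    using that(2,1)
  proof (induction C)
    case (insert x C)
    have "r (B \<union> C \<union> insert x B) + r ((B \<union> C) \<inter> insert x B) \<le> r (B \<union> C) + r (insert x B)"
      using insert.prems B by (intro matroid_submod[OF assms(1)]) auto
    moreover have "B \<union> C \<union> insert x B = B \<union> insert x C"
      by auto
    moreover have "r B \<le> r ((B \<union> C) \<inter> insert x B)"
      using insert.prems B by (intro matroid_mono[OF assms(1)]) auto
    ultimately show ?case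
      using insert stuck[of x] by simp
  qed simp
  from this[of A] show ?thesis
    using finA B matroid_mono[OF assms(1) B(1)] by (simp add: Un_absorb1)
qed

lemma matroid_basisI:
  assumes "matroid A r" "B \<subseteq> A" "r B = card B" "card B = r A"
  shows "matroid_basis A r B"
  unfolding matroid_basis_def matroid_indep_def
proof (intro conjI allI impI)
  fix I assume I: "(I \<subseteq> A \<and> r I = card I) \<and> B \<subseteq> I"
  then have "finite I"
    using assms(1) by (auto simp: matroid_def intro: finite_subset)
  moreover have "card I \<le> card B"
    using matroid_mono[OF assms(1), of I A] I assms(4) by simp
  ultimately show "I = B"
    using I by (metis card_seteq)
qed (use assms in auto)

text \<open>Brualdi's matroidal version of Koenig's theorem, by deletion and contraction: if deleting an
  edge destroys the rank condition, uncrossing the violating cover with one that obstructs the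
  contraction would violate the condition for the original graph.\<close>

theorem matroidal_koenig:
  assumes "finite E" "E \<subseteq> S \<times> T" "matroid S rS" "matroid T rT"
    and "\<And>X Y. X \<subseteq> S \<Longrightarrow> Y \<subseteq> T \<Longrightarrow> (\<forall>(s, t)\<in>E. s \<in> X \<or> t \<in> Y) \<Longrightarrow> l \<le> rS X + rT Y"
  shows "\<exists>N\<subseteq>E. card N = l \<and> inj_on fst N \<and> inj_on snd N \<and> rS (fst ` N) = l \<and> rT (snd ` N) = l"
  using assms
proof (induction E arbitrary: l rS rT rule: finite_induct)
  case empty
  then have "l \<le> rS {} + rT {}"
    by blast
  moreover have "rS {} = 0" "rT {} = 0"
    using matroid_rank_le_card[OF empty.prems(2), of "{}"]
      matroid_rank_le_card[OF empty.prems(3), of "{}"] by simp_all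
  ultimately show ?case by simp
next
  case (insert e E)
  obtain s t where e: "e = (s, t)" by fastforce
  have st: "s \<in> S" "t \<in> T" and E: "E \<subseteq> S \<times> T"
    using insert.prems(1) e by auto
  show ?case
  proof (cases "\<forall>X Y. X \<subseteq> S \<longrightarrow> Y \<subseteq> T \<longrightarrow> (\<forall>(s, t)\<in>E. s \<in> X \<or> t \<in> Y) \<longrightarrow> l \<le> rS X + rT Y")
    case True
    then show ?thesis
      using insert.IH[OF E insert.prems(2,3), of l] by blast
  next
    case False
    then obtain X Y where XY: "X \<subseteq> S" "Y \<subseteq> T" "\<forall>(s, t)\<in>E. s \<in> X \<or> t \<in> Y" "rS X + rT Y < l"
      by (auto simp: not_le)
    \<comment> \<open>Adding either end of \<open>e\<close> to the violating cover makes it cover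
      \<open>e\<close> too, so its rank must grow. Hence neither end is a loop and both can be
      contracted.\<close>
    have "l \<le> rS (insert s X) + rT Y" "l \<le> rS X + rT (insert t Y)"
      using XY st e by (auto intro!: insert.prems(4))
    moreover have "rS (insert s X) \<le> rS X + rS {s}" "rT (insert t Y) \<le> rT Y + rT {t}"
      using matroid_submod[OF insert.prems(2), of X "{s}"] matroid_submod[OF insert.prems(3), of Y "{t}"]
        XY st by auto
    moreover have "rS {s} \<le> 1" "rT {t} \<le> 1"
      using matroid_rank_le_card[OF insert.prems(2), of "{s}"]
        matroid_rank_le_card[OF insert.prems(3), of "{t}"] st by auto
    ultimately have s1: "rS {s} = 1" and t1: "rT {t} = 1" and l: "l \<ge> 1"
      using XY(4) by linarith+
    let ?qS = "\<lambda>X. rS (insert s X) - 1" and ?qT = "\<lambda>X. rT (insert t X) - 1"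
    have cond: "l - 1 \<le> ?qS X' + ?qT Y'"
      if c: "X' \<subseteq> S" "Y' \<subseteq> T" "\<forall>(s, t)\<in>E. s \<in> X' \<or> t \<in> Y'" for X' Y'
    proof -
      define X2 Y2 where "X2 = insert s X'" and "Y2 = insert t Y'"
      have 2: "X2 \<subseteq> S" "Y2 \<subseteq> T"
        using c st by (auto simp: X2_def Y2_def)
      \<comment> \<open>Both pairs cover \<open>insert e E\<close>: an edge of \<open>E\<close> is
        covered by each of the two original covers, and \<open>e\<close> has \<open>s\<close> in
        \<open>X2\<close> and \<open>t\<close> in \<open>Y2\<close>. As \<open>(X, Y)\<close> falls
        short of \<open>l\<close>, submodularity leaves at least \<open>l + 1\<close> for
        \<open>(X2, Y2)\<close>, and the two contractions take away 2.\<close>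
      have "l \<le> rS (X \<inter> X2) + rT (Y \<union> Y2)" "l \<le> rS (X \<union> X2) + rT (Y \<inter> Y2)"
        using XY c 2 e by (intro insert.prems(4); force simp: X2_def Y2_def)+
      moreover have "rS (X \<union> X2) + rS (X \<inter> X2) \<le> rS X + rS X2"
          "rT (Y \<union> Y2) + rT (Y \<inter> Y2) \<le> rT Y + rT Y2"
        using insert.prems(2,3) XY 2 by (auto intro: matroid_submod)
      ultimately have "l + 1 \<le> rS X2 + rT Y2"
        using XY(4) by linarith
      then show ?thesis
        by (simp add: X2_def Y2_def)
    qed
    obtain N where N: "N \<subseteq> E" "card N = l - 1" "inj_on fst N" "inj_on snd N"
      "?qS (fst ` N) = l - 1" "?qT (snd ` N) = l - 1"
      using insert.IH[OF E matroid_contract[OF insert.prems(2) st(1) s1]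
          matroid_contract[OF insert.prems(3) st(2) t1] cond] by blast
    have finN: "finite N"
      using N(1) insert.hyps(1) finite_subset by blast
    have sub: "fst ` N \<subseteq> S" "snd ` N \<subseteq> T"
      using N(1) E by auto
    have ge: "1 \<le> rS (insert s (fst ` N))" "1 \<le> rT (insert t (snd ` N))"
      using matroid_mono[OF insert.prems(2), of "{s}" "insert s (fst ` N)"]
        matroid_mono[OF insert.prems(3), of "{t}" "insert t (snd ` N)"] s1 t1 sub st by auto
    have r: "rS (insert s (fst ` N)) = l" "rT (insert t (snd ` N)) = l"
      using N(5,6) ge l by linarith+
    \<comment> \<open>The \<open>l - 1\<close> ends of \<open>N\<close> have too small a rank to
      contain \<open>s\<close> or \<open>t\<close> already, because adding these nodes gives rank
      \<open>l\<close>.\<close>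
    have "rS (fst ` N) \<le> l - 1" "rT (snd ` N) \<le> l - 1"
      using matroid_rank_le_card[OF insert.prems(2) sub(1)]
        matroid_rank_le_card[OF insert.prems(3) sub(2)] N(2,3,4) by (simp_all add: card_image)
    then have "insert s (fst ` N) \<noteq> fst ` N" "insert t (snd ` N) \<noteq> snd ` N"
      using r l by auto
    then have new: "s \<notin> fst ` N" "t \<notin> snd ` N"
      by blast+
    show ?thesis
    proof (intro exI[of _ "insert e N"] conjI)
      have "e \<notin> N"
        using new e by force
      then show "card (insert e N) = l"
        using N(2) finN l by simp
      show "inj_on fst (insert e N)" "inj_on snd (insert e N)"
        using N(3,4) new e by auto
      show "rS (fst ` insert e N) = l" "rT (snd ` insert e N) = l"
        using r e by simp_all
    qed (use N(1) in auto)
  qed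
qed

section \<open>Demands of a degree specification\<close>

text \<open>Merges all demands at the same node \<open>x\<close> into one. Each is the non-positive
  number \<open>m x - card (G x)\<close> plus the size of its own part
  \<open>G x \<inter> C Z\<close>. The parts are disjoint, so their sizes add up to that of the
  union, and dropping all but one copy of the non-positive number only increases the sum.\<close>

lemma sum_disjoint_parts_le:
  fixes f :: "'b \<Rightarrow> 'c" and G :: "'c \<Rightarrow> 'd set" and C :: "'b \<Rightarrow> 'd set" and m :: "'c \<Rightarrow> nat"
  assumes "finite I"
    and G: "\<And>x. x \<in> f ` I \<Longrightarrow> finite (G x) \<and> m x \<le> card (G x)"
    and disj: "\<And>Z W. Z \<in> I \<Longrightarrow> W \<in> I \<Longrightarrow> Z \<noteq> W \<Longrightarrow> f Z = f W \<Longrightarrow> G (f Z) \<inter> C Z \<inter> C W = {}"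
  shows "(\<Sum>Z\<in>I. int (m (f Z)) - int (card (G (f Z) - C Z))) \<le>
    (\<Sum>x\<in>f ` I. int (m x) - int (card (G x - \<Union> (C ` {Z \<in> I. f Z = x}))))"
proof -
  have "(\<Sum>Z\<in>I. int (m (f Z)) - int (card (G (f Z) - C Z))) =
      (\<Sum>x\<in>f ` I. \<Sum>Z\<in>{Z \<in> I. f Z = x}. int (m (f Z)) - int (card (G (f Z) - C Z)))"
    using assms(1) by (rule sum.image_gen)
  also have "\<dots> \<le> (\<Sum>x\<in>f ` I. int (m x) - int (card (G x - \<Union> (C ` {Z \<in> I. f Z = x}))))"
  proof (rule sum_mono)
    fix x assume x: "x \<in> f ` I"
    define J where "J = {Z \<in> I. f Z = x}"
    have J: "finite J" "J \<noteq> {}"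
      using assms(1) x by (auto simp: J_def)
    have Gx: "finite (G x)" "m x \<le> card (G x)"
      using G[OF x] by auto
    have split: "int (card (G x - K)) = int (card (G x)) - int (card (G x \<inter> K))" for K
      using card_Int_Diff[OF Gx(1), of K] by simp
    have "(\<Sum>Z\<in>J. int (m (f Z)) - int (card (G (f Z) - C Z))) =
        (\<Sum>Z\<in>J. (int (m x) - int (card (G x))) + int (card (G x \<inter> C Z)))"
    proof (rule sum.cong)
      fix Z assume "Z \<in> J"
      then have "f Z = x"
        by (simp add: J_def)
      then show "int (m (f Z)) - int (card (G (f Z) - C Z)) =
          (int (m x) - int (card (G x))) + int (card (G x \<inter> C Z))"
        using split[of "C Z"] by simp
    qed simp
    also have "\<dots> = int (card J) * (int (m x) - int (card (G x))) + (\<Sum>Z\<in>J. int (card (G x \<inter> C Z)))"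
      unfolding sum.distrib sum_constant by simp
    also have "(\<Sum>Z\<in>J. int (card (G x \<inter> C Z))) = int (card (\<Union>Z\<in>J. G x \<inter> C Z))"
    proof -
      have "card (\<Union>Z\<in>J. G x \<inter> C Z) = (\<Sum>Z\<in>J. card (G x \<inter> C Z))"
      proof (rule card_UN_disjoint)
        show "\<forall>Z\<in>J. \<forall>W\<in>J. Z \<noteq> W \<longrightarrow> G x \<inter> C Z \<inter> (G x \<inter> C W) = {}"
        proof (intro ballI impI)
          fix Z W assume ZW: "Z \<in> J" "W \<in> J" "Z \<noteq> W"
          then have "G (f Z) \<inter> C Z \<inter> C W = {}" "f Z = x"
            using disj[of Z W] by (simp_all add: J_def)
          then show "G x \<inter> C Z \<inter> (G x \<inter> C W) = {}"
            by blast
        qed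
      qed (use J Gx in auto)
      then show ?thesis by simp
    qed
    also have "(\<Union>Z\<in>J. G x \<inter> C Z) = G x \<inter> \<Union> (C ` J)"
      by blast
    also have "int (card J) * (int (m x) - int (card (G x))) \<le> 1 * (int (m x) - int (card (G x)))"
    proof (rule mult_right_mono_neg)
      have "card J \<ge> 1"
        using J by (simp add: Suc_le_eq card_gt_0_iff)
      then show "1 \<le> int (card J)" by simp
      show "int (m x) - int (card (G x)) \<le> 0"
        using Gx(2) by simp
    qed
    finally show "(\<Sum>Z\<in>{Z \<in> I. f Z = x}. int (m (f Z)) - int (card (G (f Z) - C Z))) \<le>
        int (m x) - int (card (G x - \<Union> (C ` {Z \<in> I. f Z = x})))"
      unfolding split J_def by simp
  qed
  finally show ?thesis .
qed

lemma sum_size_filter_eq: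
  assumes "finite A"
  shows "(\<Sum>a\<in>A. size {#e \<in># M. f e = a#}) = size {#e \<in># M. f e \<in> A#}"
proof (induction M)
  case (add x M)
  have "(\<Sum>a\<in>A. size {#e \<in># add_mset x M. f e = a#}) =
      (\<Sum>a\<in>A. of_bool (f x = a) + size {#e \<in># M. f e = a#})"
    by (rule sum.cong) auto
  also have "\<dots> = (\<Sum>a\<in>A. of_bool (f x = a)) + size {#e \<in># M. f e \<in> A#}"
    using add by (simp only: sum.distrib)
  also have "(\<Sum>a\<in>A. of_bool (f x = a)) = (of_bool (f x \<in> A) :: nat)"
    using assms by (simp add: of_bool_def)
  finally show ?case by simp
qed simp

lemma sum_le_imp_eq:
  fixes f g :: "'b \<Rightarrow> nat"
  assumes "finite A" "\<And>a. a \<in> A \<Longrightarrow> f a \<le> g a" "sum g A \<le> sum f A" "a \<in> A"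
  shows "g a = f a"
proof (rule ccontr)
  assume "g a \<noteq> f a"
  then have "f a < g a"
    using assms(2,4) by (simp add: le_neq_trans)
  then have "sum f A < sum g A"
    using assms by (intro sum_strict_mono_ex1) auto
  with assms(3) show False by simp
qed

text \<open>The two inequalities of the theorem over \<open>nat\<close>, with negative terms moved
  to the right; \<open>card (X \<times> Y - H)\<close> is the number of edges of the bipartite
  complement between \<open>X\<close> and \<open>Y\<close>.\<close>

locale matroidal_degree_spec =
  fixes S T :: "'a set" and H :: "('a \<times> 'a) set"
    and rS rT :: "'a set \<Rightarrow> nat" and mS mT :: "'a \<Rightarrow> nat" and l \<gamma> :: nat
  assumes fin: "finite S" "finite T"
    and mat: "matroid S rS" "matroid T rT"
    and rank: "rS S = l" "rT T = l"
    and total: "sum mS S = \<gamma>" "sum mT T = \<gamma>"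
    and degree_cond: "\<And>X Y. X \<subseteq> S \<Longrightarrow> Y \<subseteq> T \<Longrightarrow> sum mS X + sum mT Y \<le> \<gamma> + card (X \<times> Y - H)"
    and rank_cond: "\<And>X X' Y Y'. X \<subseteq> X' \<Longrightarrow> X' \<subseteq> S \<Longrightarrow> Y \<subseteq> Y' \<Longrightarrow> Y' \<subseteq> T \<Longrightarrow>
      H \<inter> (S - X') \<times> (T - Y') = {} \<Longrightarrow>
      sum mS X + sum mT Y + l \<le> \<gamma> + card (X \<times> Y - H) + rS X' + rT Y'"
begin

text \<open>Neighbourhoods in the bipartite complement: the partners that a new edge may
  use.\<close>

definition nS :: "'a \<Rightarrow> 'a set" where "nS s = {t \<in> T. (s, t) \<notin> H}"

definition nT :: "'a \<Rightarrow> 'a set" where "nT t = {s \<in> S. (s, t) \<notin> H}"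

text \<open>A demand \<open>v\<close> on \<open>Z\<close> asks for \<open>v\<close> edges from \<open>S \<inter> Z\<close> to \<open>T - Z\<close>. In a graph with
  \<open>\<gamma>\<close> edges the row and column demands force the degrees to be exact and every edge to be simple
  and outside \<open>H\<close>; the rank demands are the covering condition of the matroidal Koenig theorem.\<close>

definition row_demand :: "'a set \<Rightarrow> int \<Rightarrow> bool" where
  "row_demand Z v \<longleftrightarrow> (\<exists>s. S \<inter> Z = {s} \<and> v = int (mS s) - int (card (nS s \<inter> Z)))"

definition col_demand :: "'a set \<Rightarrow> int \<Rightarrow> bool" where
  "col_demand Z v \<longleftrightarrow> (\<exists>t. T - Z = {t} \<and> v = int (mT t) - int (card (nT t - Z)))"

definition rank_demand :: "'a set \<Rightarrow> int \<Rightarrow> bool" where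
  "rank_demand Z v \<longleftrightarrow> H \<inter> (S \<inter> Z) \<times> (T - Z) = {} \<and>
     v = int l - int (rS (S - Z)) - int (rT (T \<inter> Z))"

definition demands :: "'a set \<Rightarrow> int set" where
  "demands Z = {v. row_demand Z v \<or> col_demand Z v \<or> rank_demand Z v}"

text \<open>A set without demands stays outside the family instead of getting a default value, which
  would have to uncross as well. For members, the \<open>Max\<close> in \<open>demand\<close> is
  therefore over a non-empty set.\<close>

definition demand_sets :: "'a set set" where
  "demand_sets = {Z. Z \<subseteq> S \<union> T \<and> S \<inter> Z \<noteq> {} \<and> \<not> T \<subseteq> Z \<and> demands Z \<noteq> {}}"

definition demand :: "'a set \<Rightarrow> int" where "demand Z = Max (demands Z)"

lemma fin_nS [simp]: "finite (nS s)" and fin_nT [simp]: "finite (nT t)"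
  using fin by (auto simp: nS_def nT_def)

lemma finite_demands: "finite (demands Z)"
proof -
  have "finite {v. row_demand Z v}"
    by (cases "\<exists>s. S \<inter> Z = {s}") (auto simp: row_demand_def)
  moreover have "finite {v. col_demand Z v}"
    by (cases "\<exists>t. T - Z = {t}") (auto simp: col_demand_def)
  moreover have "finite {v. rank_demand Z v}"
    by (cases "H \<inter> (S \<inter> Z) \<times> (T - Z) = {}") (auto simp: rank_demand_def)
  ultimately have "finite ({v. row_demand Z v} \<union> {v. col_demand Z v} \<union> {v. rank_demand Z v})"
    by simp
  then show ?thesis
    by (rule finite_subset[rotated]) (auto simp: demands_def)
qed

lemma demand_in: "Z \<in> demand_sets \<Longrightarrow> demand Z \<in> demands Z"
  using finite_demands by (simp add: demand_def demand_sets_def)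

lemma demand_ge: "v \<in> demands Z \<Longrightarrow> v \<le> demand Z"
  using finite_demands by (simp add: demand_def)

section \<open>Uncrossing demands of equal and of different kinds\<close>

text \<open>Crossing forces a common row \<open>s\<close>, and \<open>card (nS s \<inter> Z)\<close>
  is modular in \<open>Z\<close>.\<close>

lemma uncross_row_row:
  assumes "crossing S T Z W" "row_demand Z v" "row_demand W w"
  shows "\<exists>v'\<in>demands (Z \<inter> W). \<exists>w'\<in>demands (Z \<union> W). v + w \<le> v' + w'"
proof -
  obtain s where s: "S \<inter> Z = {s}" "v = int (mS s) - int (card (nS s \<inter> Z))"
    using assms(2) by (auto simp: row_demand_def)
  obtain s' where s': "S \<inter> W = {s'}" "w = int (mS s') - int (card (nS s' \<inter> W))"
    using assms(3) by (auto simp: row_demand_def)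
  have sZ: "s \<in> S" "s \<in> Z" "\<And>x. x \<in> S \<Longrightarrow> x \<in> Z \<Longrightarrow> x = s"
    using s(1) by auto
  have sW: "s' \<in> S" "s' \<in> W" "\<And>x. x \<in> S \<Longrightarrow> x \<in> W \<Longrightarrow> x = s'"
    using s'(1) by auto
  have "s' = s"
    using assms(1) sZ(3) sW(3) unfolding crossing_def by blast
  have "card (nS s \<inter> Z) + card (nS s \<inter> W) =
      card (nS s \<inter> (Z \<union> W)) + card (nS s \<inter> (Z \<inter> W))"
    using card_Un_Int[of "nS s \<inter> Z" "nS s \<inter> W"]
    by (simp add: Int_Un_distrib Int_assoc Int_left_commute)
  moreover have "S \<inter> (Z \<inter> W) = (S \<inter> Z) \<inter> (S \<inter> W)" "S \<inter> (Z \<union> W) = (S \<inter> Z) \<union> (S \<inter> W)"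
    by blast+
  then have "S \<inter> (Z \<inter> W) = {s}" "S \<inter> (Z \<union> W) = {s}"
    using s(1) s'(1) \<open>s' = s\<close> by simp_all
  then have "int (mS s) - int (card (nS s \<inter> (Z \<inter> W))) \<in> demands (Z \<inter> W)"
    "int (mS s) - int (card (nS s \<inter> (Z \<union> W))) \<in> demands (Z \<union> W)"
    by (auto simp: demands_def row_demand_def)
  ultimately show ?thesis
    using s(2) s'(2) \<open>s' = s\<close> by (intro bexI) auto
qed

lemma uncross_col_col:
  assumes "crossing S T Z W" "col_demand Z v" "col_demand W w"
  shows "\<exists>v'\<in>demands (Z \<inter> W). \<exists>w'\<in>demands (Z \<union> W). v + w \<le> v' + w'"
proof -
  obtain t where t: "T - Z = {t}" "v = int (mT t) - int (card (nT t - Z))"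
    using assms(2) by (auto simp: col_demand_def)
  obtain t' where t': "T - W = {t'}" "w = int (mT t') - int (card (nT t' - W))"
    using assms(3) by (auto simp: col_demand_def)
  have tZ: "t \<in> T" "t \<notin> Z" "\<And>x. x \<in> T \<Longrightarrow> x \<notin> Z \<Longrightarrow> x = t"
    using t(1) by auto
  have tW: "t' \<in> T" "t' \<notin> W" "\<And>x. x \<in> T \<Longrightarrow> x \<notin> W \<Longrightarrow> x = t'"
    using t'(1) by auto
  have "t' = t"
    using assms(1) tZ(3) tW(3) unfolding crossing_def by blast
  have "card (nT t - Z) + card (nT t - W) = card (nT t - (Z \<inter> W)) + card (nT t - (Z \<union> W))"
    using card_Un_Int[of "nT t - Z" "nT t - W"] by (simp add: Diff_Int Diff_Un)
  moreover have "T - (Z \<inter> W) = (T - Z) \<union> (T - W)" "T - (Z \<union> W) = (T - Z) \<inter> (T - W)"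
    by blast+
  then have "T - (Z \<inter> W) = {t}" "T - (Z \<union> W) = {t}"
    using t(1) t'(1) \<open>t' = t\<close> by simp_all
  then have "int (mT t) - int (card (nT t - (Z \<inter> W))) \<in> demands (Z \<inter> W)"
    "int (mT t) - int (card (nT t - (Z \<union> W))) \<in> demands (Z \<union> W)"
    by (auto simp: demands_def col_demand_def)
  ultimately show ?thesis
    using t(2) t'(2) \<open>t' = t\<close> by (intro bexI) auto
qed

text \<open>\<open>Z\<close> has only \<open>s\<close> in \<open>S\<close>, and \<open>W\<close>
  omits only \<open>t\<close> from \<open>T\<close>. A pair leaving both must be
  \<open>(s, t)\<close>, which forces \<open>Z \<subseteq> W\<close>, so the demands can stay where
  they are.\<close>

lemma uncross_row_col:
  assumes "crossing S T Z W" "row_demand Z v" "col_demand W w" "Z \<subseteq> S \<union> T"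
  shows "\<exists>v'\<in>demands (Z \<inter> W). \<exists>w'\<in>demands (Z \<union> W). v + w \<le> v' + w'"
proof -
  obtain s t where st: "S \<inter> Z = {s}" "T - W = {t}"
    using assms(2,3) by (auto simp: row_demand_def col_demand_def)
  have "s \<in> W" "t \<notin> Z"
    using assms(1) st unfolding crossing_def by auto
  moreover have "x = s \<or> x \<in> W \<or> x = t" if "x \<in> Z" for x
    using equalityD1[OF st(1)] equalityD1[OF st(2)] assms(4) that by blast
  ultimately have "Z \<subseteq> W"
    by blast
  then have "Z \<inter> W = Z" "Z \<union> W = W"
    by auto
  then show ?thesis
    using assms(2,3) by (auto simp: demands_def)
qed

text \<open>The row demand moves to the intersection and the rank demand to the union. The rectangle
  of \<open>W\<close> avoids \<open>H\<close>, so all of \<open>T \<inter> Z - W\<close> lies in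
  \<open>nS s\<close>; the row demand therefore gains the full
  \<open>card (T \<inter> Z - W)\<close>, which pays for the growth of the \<open>rT\<close>
  term.\<close>

lemma uncross_row_rank:
  assumes "crossing S T Z W" "row_demand Z v" "rank_demand W w"
  shows "\<exists>v'\<in>demands (Z \<inter> W). \<exists>w'\<in>demands (Z \<union> W). v + w \<le> v' + w'"
proof -
  obtain s where s: "S \<inter> Z = {s}" "v = int (mS s) - int (card (nS s \<inter> Z))"
    using assms(2) by (auto simp: row_demand_def)
  have W: "H \<inter> (S \<inter> W) \<times> (T - W) = {}" "w = int l - int (rS (S - W)) - int (rT (T \<inter> W))"
    using assms(3) by (auto simp: rank_demand_def)
  have sZ: "s \<in> S" "s \<in> Z" "\<And>x. x \<in> S \<Longrightarrow> x \<in> Z \<Longrightarrow> x = s"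
    using s(1) by auto
  have sW: "s \<in> W"
    using assms(1) sZ(3) unfolding crossing_def by blast
  have "S \<inter> (Z \<inter> W) = (S \<inter> Z) \<inter> W" "S \<inter> (Z \<union> W) = (S \<inter> Z) \<union> (S \<inter> W)"
    "S - (Z \<union> W) = (S - W) - (S \<inter> Z)"
    by blast+
  then have Int: "S \<inter> (Z \<inter> W) = {s}" and Un: "S \<inter> (Z \<union> W) = S \<inter> W" "S - (Z \<union> W) = S - W"
    unfolding s(1) using sW sZ(1) by auto
  have "nS s \<inter> Z = (nS s \<inter> (Z \<inter> W)) \<union> (T \<inter> Z - W)"
    using W(1) sW sZ(1) by (auto simp: nS_def)
  moreover have "card ((nS s \<inter> (Z \<inter> W)) \<union> (T \<inter> Z - W)) =
      card (nS s \<inter> (Z \<inter> W)) + card (T \<inter> Z - W)"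
    using fin by (intro card_Un_disjoint) auto
  moreover have "rT (T \<inter> (Z \<union> W)) \<le> rT (T \<inter> W) + card (T \<inter> Z - W)"
  proof -
    have "T \<inter> (Z \<union> W) = T \<inter> W \<union> (T \<inter> Z - W)" by auto
    then show ?thesis
      using matroid_rank_Un_le_card[OF mat(2), of "T \<inter> W" "T \<inter> Z - W"] by auto
  qed
  moreover have "int (mS s) - int (card (nS s \<inter> (Z \<inter> W))) \<in> demands (Z \<inter> W)"
    using Int by (auto simp: demands_def row_demand_def)
  moreover have "H \<inter> (S \<inter> (Z \<union> W)) \<times> (T - (Z \<union> W)) = {}"
    unfolding Un(1) using W(1) by blast
  then have "int l - int (rS (S - (Z \<union> W))) - int (rT (T \<inter> (Z \<union> W))) \<in> demands (Z \<union> W)"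
    by (simp add: demands_def rank_demand_def)
  ultimately show ?thesis
    using s(2) W(2) Un(2) by (intro bexI) auto
qed

text \<open>Mirror image of \<open>uncross_row_rank\<close>: the column demand moves to the union
  and gains \<open>card (S \<inter> W - Z)\<close>, which pays for the growth of the
  \<open>rS\<close> term in the intersection.\<close>

lemma uncross_col_rank:
  assumes "crossing S T Z W" "col_demand Z v" "rank_demand W w"
  shows "\<exists>v'\<in>demands (Z \<inter> W). \<exists>w'\<in>demands (Z \<union> W). v + w \<le> v' + w'"
proof -
  obtain t where t: "T - Z = {t}" "v = int (mT t) - int (card (nT t - Z))"
    using assms(2) by (auto simp: col_demand_def)
  have W: "H \<inter> (S \<inter> W) \<times> (T - W) = {}" "w = int l - int (rS (S - W)) - int (rT (T \<inter> W))"
    using assms(3) by (auto simp: rank_demand_def)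
  have tZ: "t \<in> T" "t \<notin> Z" "\<And>x. x \<in> T \<Longrightarrow> x \<notin> Z \<Longrightarrow> x = t"
    using t(1) by auto
  have tW: "t \<notin> W"
    using assms(1) tZ(3) unfolding crossing_def by blast
  have "T - (Z \<union> W) = (T - Z) - W" "T - (Z \<inter> W) = (T - Z) \<union> (T - W)"
    "T \<inter> (Z \<inter> W) = (T \<inter> W) - (T - Z)"
    by blast+
  then have Un: "T - (Z \<union> W) = {t}" and Int: "T - (Z \<inter> W) = T - W" "T \<inter> (Z \<inter> W) = T \<inter> W"
    unfolding t(1) using tW tZ(1) by auto
  have "nT t - Z = (nT t - (Z \<union> W)) \<union> (S \<inter> W - Z)"
    using W(1) tW tZ(1) by (auto simp: nT_def)
  moreover have "card ((nT t - (Z \<union> W)) \<union> (S \<inter> W - Z)) =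
      card (nT t - (Z \<union> W)) + card (S \<inter> W - Z)"
    using fin by (intro card_Un_disjoint) auto
  moreover have "rS (S - (Z \<inter> W)) \<le> rS (S - W) + card (S \<inter> W - Z)"
  proof -
    have "S - (Z \<inter> W) = (S - W) \<union> (S \<inter> W - Z)" by auto
    then show ?thesis
      using matroid_rank_Un_le_card[OF mat(1), of "S - W" "S \<inter> W - Z"] by auto
  qed
  moreover have "int (mT t) - int (card (nT t - (Z \<union> W))) \<in> demands (Z \<union> W)"
    using Un by (auto simp: demands_def col_demand_def)
  moreover have "H \<inter> (S \<inter> (Z \<inter> W)) \<times> (T - (Z \<inter> W)) = {}"
    unfolding Int(1) using W(1) by blast
  then have "int l - int (rS (S - (Z \<inter> W))) - int (rT (T \<inter> (Z \<inter> W))) \<in> demands (Z \<inter> W)"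
    by (simp add: demands_def rank_demand_def)
  ultimately show ?thesis
    using t(2) W(2) Int(2) by (intro bexI) auto
qed

text \<open>Both new rectangles lie in the union of the old ones, so they avoid \<open>H\<close>;
  the values follow from submodularity of the two ranks.\<close>

lemma uncross_rank_rank:
  assumes "rank_demand Z v" "rank_demand W w"
  shows "\<exists>v'\<in>demands (Z \<inter> W). \<exists>w'\<in>demands (Z \<union> W). v + w \<le> v' + w'"
proof -
  have Z: "H \<inter> (S \<inter> Z) \<times> (T - Z) = {}" "v = int l - int (rS (S - Z)) - int (rT (T \<inter> Z))"
    and W: "H \<inter> (S \<inter> W) \<times> (T - W) = {}" "w = int l - int (rS (S - W)) - int (rT (T \<inter> W))"
    using assms by (auto simp: rank_demand_def)
  have "rS (S - (Z \<inter> W)) + rS (S - (Z \<union> W)) \<le> rS (S - Z) + rS (S - W)"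
    using matroid_submod[OF mat(1), of "S - Z" "S - W"] by (simp add: Diff_Int Diff_Un)
  moreover have "rT (T \<inter> (Z \<union> W)) + rT (T \<inter> (Z \<inter> W)) \<le> rT (T \<inter> Z) + rT (T \<inter> W)"
    using matroid_submod[OF mat(2), of "T \<inter> Z" "T \<inter> W"]
    by (simp add: Int_Un_distrib Int_assoc Int_left_commute)
  moreover have "H \<inter> (S \<inter> (Z \<inter> W)) \<times> (T - (Z \<inter> W)) = {}"
    "H \<inter> (S \<inter> (Z \<union> W)) \<times> (T - (Z \<union> W)) = {}"
    using Z(1) W(1) by blast+
  then have "int l - int (rS (S - (Z \<inter> W))) - int (rT (T \<inter> (Z \<inter> W))) \<in> demands (Z \<inter> W)"
    "int l - int (rS (S - (Z \<union> W))) - int (rT (T \<inter> (Z \<union> W))) \<in> demands (Z \<union> W)"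
    by (simp_all add: demands_def rank_demand_def)
  ultimately show ?thesis
    using Z(2) W(2) by (intro bexI) auto
qed

lemma uncross_demands:
  assumes "crossing S T Z W" "v \<in> demands Z" "w \<in> demands W" "Z \<subseteq> S \<union> T" "W \<subseteq> S \<union> T"
  shows "\<exists>v'\<in>demands (Z \<inter> W). \<exists>w'\<in>demands (Z \<union> W). v + w \<le> v' + w'"
proof -
  note cr = assms(1) crossing_commute[THEN iffD1, OF assms(1)]
  have flip: ?thesis if "\<exists>v'\<in>demands (W \<inter> Z). \<exists>w'\<in>demands (W \<union> Z). w + v \<le> v' + w'"
    using that by (simp add: Int_commute Un_commute add.commute)
  consider "row_demand Z v" "row_demand W w" | "col_demand Z v" "col_demand W w"
    | "rank_demand Z v" "rank_demand W w" | "row_demand Z v" "col_demand W w"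
    | "col_demand Z v" "row_demand W w" | "row_demand Z v" "rank_demand W w"
    | "rank_demand Z v" "row_demand W w" | "col_demand Z v" "rank_demand W w"
    | "rank_demand Z v" "col_demand W w"
    using assms(2,3) unfolding demands_def by blast
  then show ?thesis
  proof cases
    case 1 then show ?thesis using uncross_row_row cr by blast
  next
    case 2 then show ?thesis using uncross_col_col cr by blast
  next
    case 3 then show ?thesis using uncross_rank_rank by blast
  next
    case 4 then show ?thesis using uncross_row_col cr assms by blast
  next
    case 5 then show ?thesis by (intro flip uncross_row_col cr assms)
  next
    case 6 then show ?thesis using uncross_row_rank cr by blast
  next
    case 7 then show ?thesis by (intro flip uncross_row_rank cr)
  next
    case 8 then show ?thesis using uncross_col_rank cr by blast
  next
    case 9 then show ?thesis by (intro flip uncross_col_rank cr)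
  qed
qed

lemma crossing_supermodular_demand: "crossing_supermodular S T demand_sets demand"
  unfolding crossing_supermodular_def
proof (intro ballI impI)
  fix Z W assume ZW: "Z \<in> demand_sets" "W \<in> demand_sets" "crossing S T Z W"
  have sub: "Z \<subseteq> S \<union> T" "W \<subseteq> S \<union> T"
    using ZW by (auto simp: demand_sets_def)
  obtain v w where vw: "v \<in> demands (Z \<inter> W)" "w \<in> demands (Z \<union> W)" "demand Z + demand W \<le> v + w"
    using uncross_demands[OF ZW(3) demand_in[OF ZW(1)] demand_in[OF ZW(2)] sub] by blast
  have "S \<inter> (Z \<inter> W) \<noteq> {}" "\<not> T \<subseteq> Z \<union> W"
    using ZW(3) by (simp_all add: crossing_def)
  then have "Z \<inter> W \<in> demand_sets" "Z \<union> W \<in> demand_sets"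
    using vw(1,2) sub unfolding demand_sets_def by blast+
  then show "Z \<inter> W \<in> demand_sets \<and> Z \<union> W \<in> demand_sets \<and>
      demand Z + demand W \<le> demand (Z \<inter> W) + demand (Z \<union> W)"
    using demand_ge[OF vw(1)] demand_ge[OF vw(2)] vw(3) by linarith
qed

section \<open>Disjoint rectangles demand at most \<open>\<gamma>\<close> edges\<close>

text \<open>Disjoint rectangles have no common row or no common column. If
  \<open>A \<inter> A' = {}\<close>, the complements of \<open>A\<close> and \<open>A'\<close>
  together are \<open>S\<close>, of rank \<open>l\<close>, so submodularity cancels one of the two
  \<open>l\<close> and merges the demands into the one on
  \<open>(A \<union> A') \<times> (B \<inter> B')\<close>. The common rank makes the other case
  symmetric. Every pair of the merged rectangle still lies in an old one.\<close>

lemma merge_rank_demands: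
  assumes "finite I" "independent S T I"
  shows "\<exists>A B. A \<subseteq> S \<and> B \<subseteq> T \<and> (\<forall>e\<in>A \<times> B. \<exists>Z\<in>I. leaves e Z) \<and>
    (\<Sum>Z\<in>I. int l - int (rS (S - Z)) - int (rT (T \<inter> Z))) \<le>
      int l - int (rS (S - A)) - int (rT (T - B))"
  using assms
proof (induction I)
  case empty
  have "rT {} = 0"
    using matroid_rank_le_card[OF mat(2), of "{}"] by simp
  \<comment> \<open>The empty family needs an empty rectangle of value 0: \<open>A = {}\<close> with
    \<open>B = T\<close> gives \<open>l - l - 0\<close>, whereas \<open>B = {}\<close> would give
    \<open>- l\<close>.\<close>
  then show ?case
    using rank by (intro exI[of _ "{}"] exI[of _ T]) auto
next
  case (insert Z I)
  have "independent S T I"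
    using insert.prems by (auto simp: independent_def pairwise_insert)
  then obtain A B where AB: "A \<subseteq> S" "B \<subseteq> T" "\<And>e. e \<in> A \<times> B \<Longrightarrow> \<exists>Z\<in>I. leaves e Z"
    "(\<Sum>Z\<in>I. int l - int (rS (S - Z)) - int (rT (T \<inter> Z))) \<le>
      int l - int (rS (S - A)) - int (rT (T - B))"
    using insert.IH by blast
  define A' B' where "A' = S \<inter> Z" and "B' = T - Z"
  have Z: "S - Z = S - A'" "T \<inter> Z = T - B'" "A' \<subseteq> S" "B' \<subseteq> T"
    by (auto simp: A'_def B'_def)
  have leave: "leaves e Z" if "e \<in> A' \<times> B'" for e
    using that by (auto simp: leaves_def A'_def B'_def)
  have "A \<inter> A' = {} \<or> B \<inter> B' = {}"
  proof (rule ccontr)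
    assume "\<not> ?thesis"
    then obtain s t where st: "s \<in> A \<inter> A'" "t \<in> B \<inter> B'"
      by blast
    then obtain W where "W \<in> I" "leaves (s, t) W"
      using AB(3)[of "(s, t)"] by blast
    moreover have "leaves (s, t) Z" "(s, t) \<in> S \<times> T"
      using st leave AB(1,2) by auto
    ultimately show False
      using independent_unique[OF insert.prems] insert.hyps by blast
  qed
  moreover have subS: "rS ((S - A) \<union> (S - A')) + rS ((S - A) \<inter> (S - A')) \<le> rS (S - A) + rS (S - A')"
    by (intro matroid_submod[OF mat(1)]) auto
  moreover have subT: "rT ((T - B) \<union> (T - B')) + rT ((T - B) \<inter> (T - B')) \<le> rT (T - B) + rT (T - B')"
    by (intro matroid_submod[OF mat(2)]) auto
  moreover have sum: "(\<Sum>Z\<in>insert Z I. int l - int (rS (S - Z)) - int (rT (T \<inter> Z))) \<le>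
      int l - int (rS (S - A')) - int (rT (T - B')) + (int l - int (rS (S - A)) - int (rT (T - B)))"
    using insert.hyps AB(4) Z by simp
  ultimately show ?case
  proof (elim disjE)
    assume "A \<inter> A' = {}"
    then have "(S - A) \<union> (S - A') = S" "(S - A) \<inter> (S - A') = S - (A \<union> A')"
      "(T - B) \<union> (T - B') = T - (B \<inter> B')"
      by blast+
    then have "(\<Sum>Z\<in>insert Z I. int l - int (rS (S - Z)) - int (rT (T \<inter> Z))) \<le>
        int l - int (rS (S - (A \<union> A'))) - int (rT (T - (B \<inter> B')))"
      using subS subT sum rank by simp
    moreover have "\<exists>Z\<in>insert Z I. leaves e Z" if "e \<in> (A \<union> A') \<times> (B \<inter> B')" for e
      using that AB(3)[of e] leave[of e] by blast
    ultimately show ?thesis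
      using AB(1,2) Z(3,4) by (intro exI[of _ "A \<union> A'"] exI[of _ "B \<inter> B'"]) blast
  next
    assume "B \<inter> B' = {}"
    then have "(T - B) \<union> (T - B') = T" "(T - B) \<inter> (T - B') = T - (B \<union> B')"
      "(S - A) \<union> (S - A') = S - (A \<inter> A')"
      by blast+
    then have "(\<Sum>Z\<in>insert Z I. int l - int (rS (S - Z)) - int (rT (T \<inter> Z))) \<le>
        int l - int (rS (S - (A \<inter> A'))) - int (rT (T - (B \<union> B')))"
      using subS subT sum rank by simp
    moreover have "\<exists>Z\<in>insert Z I. leaves e Z" if "e \<in> (A \<inter> A') \<times> (B \<union> B')" for e
      using that AB(3)[of e] leave[of e] by blast
    ultimately show ?thesis
      using AB(1,2) Z(3,4) by (intro exI[of _ "A \<inter> A'"] exI[of _ "B \<union> B'"]) blast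
  qed
qed

lemma mS_le: "s \<in> S \<Longrightarrow> mS s \<le> card (nS s)"
proof -
  assume s: "s \<in> S"
  have "{s} \<times> T - H = Pair s ` nS s"
    by (auto simp: nS_def)
  then have "card ({s} \<times> T - H) = card (nS s)"
    by (simp add: card_image inj_on_def)
  then show ?thesis
    using degree_cond[of "{s}" T] s total by simp
qed

lemma mT_le: "t \<in> T \<Longrightarrow> mT t \<le> card (nT t)"
proof -
  assume t: "t \<in> T"
  have "S \<times> {t} - H = (\<lambda>s. (s, t)) ` nT t"
    by (auto simp: nT_def)
  then have "card (S \<times> {t} - H) = card (nT t)"
    by (simp add: card_image inj_on_def)
  then show ?thesis
    using degree_cond[of S "{t}"] t total by simp
qed

text \<open>\<open>P\<close> and \<open>Q\<close> are the pairs charged to the row and column demands, and \<open>A \<times> B\<close> is the merged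
  rank demand. Rows in \<open>A\<close> and columns in \<open>B\<close> are charged for all of \<open>A \<times> B\<close> they meet, which pays
  for shrinking \<open>A\<close> to \<open>A - X\<close> and \<open>B\<close> to \<open>B - Y\<close>, or for the whole rank demand if this leaves
  nothing.\<close>

lemma charged_pairs_bound:
  assumes sub: "X \<subseteq> S" "Y \<subseteq> T" "A \<subseteq> S" "B \<subseteq> T" and finPQ: "finite P" "finite Q"
    and HAB: "H \<inter> A \<times> B = {}"
    and XY: "X \<times> Y - H \<subseteq> P \<union> Q" and P: "(X \<inter> A) \<times> B \<subseteq> P" and Q: "A \<times> (Y \<inter> B) \<subseteq> Q"
  shows "int (sum mS X) - int (card P) + int (sum mT Y) - int (card Q)
    + (int l - int (rS (S - A)) - int (rT (T - B))) \<le> int \<gamma>"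
proof -
  have fin': "finite A" "finite B" "finite X" "finite Y"
    using sub fin finite_subset by blast+
  have PQ: "card P + card Q = card (P \<union> Q) + card (P \<inter> Q)"
    using card_Un_Int finPQ by blast
  have deg: "sum mS X + sum mT Y \<le> \<gamma> + card (X \<times> Y - H)"
    using degree_cond sub by blast
  have rA: "l \<le> rS (S - A) + card A"
    using matroid_rank_Un_le_card[OF mat(1), of "S - A" A] sub rank by (simp add: Un_absorb2)
  have rB: "l \<le> rT (T - B) + card B"
    using matroid_rank_Un_le_card[OF mat(2), of "T - B" B] sub rank by (simp add: Un_absorb2)
  have finU: "finite (P \<union> Q)" "finite (P \<inter> Q)"
    using finPQ by auto
  have finXY: "finite (X \<times> Y - H)"
    using fin' by blast
  consider "A = {} \<or> B = {}" | "A \<noteq> {}" "B \<noteq> {}" "A \<subseteq> X" | "A \<noteq> {}" "B \<noteq> {}" "B \<subseteq> Y"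
    | "A - X \<noteq> {}" "B - Y \<noteq> {}"
    by blast
  then show ?thesis
  proof cases
    case 1
    then have "l \<le> rS (S - A) + rT (T - B)"
      using rank by auto
    moreover have "card (X \<times> Y - H) \<le> card (P \<union> Q)"
      using XY finU by (intro card_mono)
    ultimately show ?thesis
      using deg PQ by linarith
  next
    \<comment> \<open>Here \<open>A \<times> B \<subseteq> P\<close>. Its pairs outside
      \<open>Y\<close> are extra in \<open>P \<union> Q\<close>, those inside \<open>Y\<close> are
      counted twice, so the surplus is \<open>card A * card B\<close>, at least
      \<open>card A\<close>. This exceeds or equals the whole rank demand, and the degree condition
      suffices.\<close>
    case 2
    have "card (X \<times> Y - H) + card (A \<times> (B - Y)) = card ((X \<times> Y - H) \<union> A \<times> (B - Y))"
      using fin' finXY by (intro card_Un_disjoint[symmetric]) auto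
    also have "\<dots> \<le> card (P \<union> Q)"
      using XY P 2(3) finU by (intro card_mono) blast+
    finally have "card (X \<times> Y - H) + card (A \<times> (B - Y)) \<le> card (P \<union> Q)" .
    moreover have "A \<times> (B \<inter> Y) \<subseteq> P \<inter> Q"
      using P Q 2(3) by blast
    then have "card (A \<times> (B \<inter> Y)) \<le> card (P \<inter> Q)"
      using finU by (intro card_mono)
    moreover have "card (A \<times> (B - Y)) + card (A \<times> (B \<inter> Y)) = card A * card B"
      using card_Int_Diff[OF fin'(2), of Y] by (simp add: card_cartesian_product distrib_left)
    moreover have "card A \<le> card A * card B"
      using 2(2) fin' by (simp add: card_gt_0_iff Suc_le_eq)
    ultimately show ?thesis
      using deg PQ rA by linarith
  next
    case 3
    have "card (X \<times> Y - H) + card ((A - X) \<times> B) = card ((X \<times> Y - H) \<union> (A - X) \<times> B)"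
      using fin' finXY by (intro card_Un_disjoint[symmetric]) auto
    also have "\<dots> \<le> card (P \<union> Q)"
      using XY Q 3(3) finU by (intro card_mono) blast+
    finally have "card (X \<times> Y - H) + card ((A - X) \<times> B) \<le> card (P \<union> Q)" .
    moreover have "(A \<inter> X) \<times> B \<subseteq> P \<inter> Q"
      using P Q 3(3) by blast
    then have "card ((A \<inter> X) \<times> B) \<le> card (P \<inter> Q)"
      using finU by (intro card_mono)
    moreover have "card ((A - X) \<times> B) + card ((A \<inter> X) \<times> B) = card A * card B"
      using card_Int_Diff[OF fin'(1), of X] by (simp add: card_cartesian_product distrib_right)
    moreover have "card B \<le> card A * card B"
      using 3(1) fin' by (simp add: card_gt_0_iff Suc_le_eq)
    ultimately show ?thesis
      using deg PQ rB by linarith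
  next
    \<comment> \<open>The rank condition applies to \<open>S - (A - X)\<close> and
      \<open>T - (B - Y)\<close>, which contain \<open>X\<close> and \<open>Y\<close>. Passing to
      them raises the ranks by at most \<open>card (X \<inter> A)\<close> and
      \<open>card (Y \<inter> B)\<close>; as \<open>B - Y\<close> and \<open>A - X\<close> are
      non-empty, the surplus pairs in \<open>P \<union> Q\<close> cover both amounts.\<close>
    case 4
    have "card (X \<times> Y - H) + card ((X \<inter> A) \<times> (B - Y)) + card ((A - X) \<times> (Y \<inter> B)) =
        card ((X \<times> Y - H) \<union> (X \<inter> A) \<times> (B - Y) \<union> (A - X) \<times> (Y \<inter> B))"
    proof -
      have "card ((X \<times> Y - H) \<union> (X \<inter> A) \<times> (B - Y)) =
          card (X \<times> Y - H) + card ((X \<inter> A) \<times> (B - Y))"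
        using fin' finXY by (intro card_Un_disjoint) auto
      moreover have "card ((X \<times> Y - H) \<union> (X \<inter> A) \<times> (B - Y) \<union> (A - X) \<times> (Y \<inter> B)) =
          card ((X \<times> Y - H) \<union> (X \<inter> A) \<times> (B - Y)) + card ((A - X) \<times> (Y \<inter> B))"
        using fin' finXY by (intro card_Un_disjoint) auto
      ultimately show ?thesis by linarith
    qed
    also have "\<dots> \<le> card (P \<union> Q)"
      using XY P Q finU by (intro card_mono) blast+
    finally have "card (X \<times> Y - H) + card ((X \<inter> A) \<times> (B - Y)) + card ((A - X) \<times> (Y \<inter> B))
        \<le> card (P \<union> Q)" .
    moreover have "card (X \<inter> A) \<le> card ((X \<inter> A) \<times> (B - Y))"
      "card (Y \<inter> B) \<le> card ((A - X) \<times> (Y \<inter> B))"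
      using 4 fin' by (simp_all add: card_cartesian_product card_gt_0_iff Suc_le_eq)
    moreover have "rS (S - (A - X)) \<le> rS (S - A) + card (X \<inter> A)"
    proof -
      have "S - (A - X) = (S - A) \<union> (X \<inter> A)"
        using sub by blast
      then show ?thesis
        using matroid_rank_Un_le_card[OF mat(1), of "S - A" "X \<inter> A"] sub by auto
    qed
    moreover have "rT (T - (B - Y)) \<le> rT (T - B) + card (Y \<inter> B)"
    proof -
      have "T - (B - Y) = (T - B) \<union> (Y \<inter> B)"
        using sub by blast
      then show ?thesis
        using matroid_rank_Un_le_card[OF mat(2), of "T - B" "Y \<inter> B"] sub by auto
    qed
    moreover have "sum mS X + sum mT Y + l
        \<le> \<gamma> + card (X \<times> Y - H) + rS (S - (A - X)) + rT (T - (B - Y))"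
      using sub HAB by (intro rank_cond) auto
    ultimately show ?thesis
      using PQ by linarith
  qed
qed

text \<open>The family is split by the kind of demand that attains the maximum. A pair outside
  \<open>H\<close> in a row of \<open>X\<close> but not in \<open>P\<close> lies in a rectangle of
  \<open>I1\<close>; likewise for columns, \<open>Q\<close> and \<open>I2\<close>, while pairs of
  \<open>A \<times> B\<close> lie in rectangles of \<open>I3\<close>. Independence places each pair
  in at most one rectangle, which yields the three inclusions required by
  \<open>charged_pairs_bound\<close>.\<close>

lemma independent_demand_le:
  assumes I: "I \<subseteq> demand_sets" "finite I" "independent S T I"
  shows "sum demand I \<le> int \<gamma>"
proof -
  define I1 where "I1 = {Z \<in> I. row_demand Z (demand Z)}"
  define I2 where "I2 = {Z \<in> I - I1. col_demand Z (demand Z)}"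
  define I3 where "I3 = I - I1 - I2"
  have parts: "I1 \<subseteq> I" "I2 \<subseteq> I" "I3 \<subseteq> I" "I1 \<inter> I2 = {}" "I1 \<inter> I3 = {}" "I2 \<inter> I3 = {}"
    and I_eq: "I = I1 \<union> I2 \<union> I3"
    by (auto simp: I1_def I2_def I3_def)
  have fins: "finite I1" "finite I2" "finite I3"
    using parts I(2) finite_subset by blast+
  have uniq: "Z = W" if "Z \<in> I" "W \<in> I" "leaves e Z" "leaves e W" "e \<in> S \<times> T" for Z W e
    using independent_unique[OF I(3)] that by blast
  define f g where "f Z = the_elem (S \<inter> Z)" and "g Z = the_elem (T - Z)" for Z
  \<comment> \<open>The double complement gives the shape \<open>G (f Z) - C Z\<close> of
    \<open>sum_disjoint_parts_le\<close> with \<open>C = uminus\<close>; columns use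
    \<open>C = id\<close>.\<close>
  have f: "S \<inter> Z = {f Z}" "demand Z = int (mS (f Z)) - int (card (nS (f Z) - (- Z)))"
    if Z: "Z \<in> I1" for Z
  proof -
    obtain s where s: "S \<inter> Z = {s}" "demand Z = int (mS s) - int (card (nS s \<inter> Z))"
      using Z unfolding I1_def row_demand_def by blast
    then have "f Z = s"
      by (simp add: f_def)
    then show "S \<inter> Z = {f Z}" "demand Z = int (mS (f Z)) - int (card (nS (f Z) - (- Z)))"
      using s by (simp_all add: Diff_eq)
  qed
  have g: "T - Z = {g Z}" "demand Z = int (mT (g Z)) - int (card (nT (g Z) - Z))"
    if Z: "Z \<in> I2" for Z
  proof -
    obtain t where t: "T - Z = {t}" "demand Z = int (mT t) - int (card (nT t - Z))"
      using Z unfolding I2_def col_demand_def by blast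
    then have "g Z = t"
      by (simp add: g_def)
    then show "T - Z = {g Z}" "demand Z = int (mT (g Z)) - int (card (nT (g Z) - Z))"
      using t by simp_all
  qed
  have h: "H \<inter> (S \<inter> Z) \<times> (T - Z) = {}"
      "demand Z = int l - int (rS (S - Z)) - int (rT (T \<inter> Z))" if Z: "Z \<in> I3" for Z
  proof -
    have "demand Z \<in> demands Z"
      using Z parts I(1) demand_in by blast
    then have "rank_demand Z (demand Z)"
      using Z by (auto simp: I1_def I2_def I3_def demands_def)
    then show "H \<inter> (S \<inter> Z) \<times> (T - Z) = {}"
      "demand Z = int l - int (rS (S - Z)) - int (rT (T \<inter> Z))"
      by (simp_all add: rank_demand_def)
  qed
  define X Y where "X = f ` I1" and "Y = g ` I2"
  have fS: "f Z \<in> S" "f Z \<in> Z" if "Z \<in> I1" for Z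
    using f(1)[OF that] by auto
  have gT: "g Z \<in> T" "g Z \<notin> Z" if "Z \<in> I2" for Z
    using g(1)[OF that] by auto
  have XYsub: "X \<subseteq> S" "Y \<subseteq> T"
    using fS gT by (auto simp: X_def Y_def)
  \<comment> \<open>Within \<open>T\<close>, \<open>U s\<close> consists of the columns of the row
    rectangles at \<open>s\<close>; within \<open>S\<close>, \<open>V t\<close> consists of the rows
    of the column rectangles at \<open>t\<close>. So \<open>P\<close> and \<open>Q\<close> collect
    the admissible pairs that these rectangles miss.\<close>
  define U where "U s = \<Union> (uminus ` {Z \<in> I1. f Z = s})" for s
  define V where "V t = \<Union> (id ` {Z \<in> I2. g Z = t})" for t
  define P where "P = (SIGMA s:X. nS s - U s)"
  define Q where "Q = prod.swap ` (SIGMA t:Y. nT t - V t)"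
  have finXY: "finite X" "finite Y"
    using fins by (auto simp: X_def Y_def)
  have cP: "card P = (\<Sum>s\<in>X. card (nS s - U s))"
    unfolding P_def using finXY by (intro card_SigmaI) auto
  have cQ: "card Q = (\<Sum>t\<in>Y. card (nT t - V t))"
  proof -
    have "card Q = card (SIGMA t:Y. nT t - V t)"
      unfolding Q_def by (intro card_image) (simp add: inj_on_def)
    then show ?thesis using finXY by simp
  qed
  have "sum demand I1 = (\<Sum>Z\<in>I1. int (mS (f Z)) - int (card (nS (f Z) - (- Z))))"
    using f(2) by (intro sum.cong) auto
  also have "\<dots> \<le> (\<Sum>s\<in>X. int (mS s) - int (card (nS s - U s)))"
    unfolding X_def U_def
  proof (rule sum_disjoint_parts_le[OF fins(1)])
    fix Z W assume ZW: "Z \<in> I1" "W \<in> I1" "Z \<noteq> W" "f Z = f W"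
    show "nS (f Z) \<inter> - Z \<inter> - W = {}"
    proof (rule ccontr)
      assume "nS (f Z) \<inter> - Z \<inter> - W \<noteq> {}"
      then obtain t where "t \<in> T" "t \<notin> Z" "t \<notin> W"
        by (auto simp: nS_def)
      then have "Z = W"
        using uniq[of Z W "(f Z, t)"] ZW fS[of Z] fS[of W] parts by (auto simp: leaves_def)
      with ZW show False by blast
    qed
  next
    fix s assume "s \<in> f ` I1"
    then show "finite (nS s) \<and> mS s \<le> card (nS s)"
      using mS_le fS by auto
  qed
  finally have s1: "sum demand I1 \<le> int (sum mS X) - int (card P)"
    by (simp add: cP sum_subtractf)
  have "sum demand I2 = (\<Sum>Z\<in>I2. int (mT (g Z)) - int (card (nT (g Z) - id Z)))"
    using g(2) by (intro sum.cong) auto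
  also have "\<dots> \<le> (\<Sum>t\<in>Y. int (mT t) - int (card (nT t - V t)))"
    unfolding Y_def V_def
  proof (rule sum_disjoint_parts_le[OF fins(2)])
    fix Z W assume ZW: "Z \<in> I2" "W \<in> I2" "Z \<noteq> W" "g Z = g W"
    show "nT (g Z) \<inter> id Z \<inter> id W = {}"
    proof (rule ccontr)
      assume "nT (g Z) \<inter> id Z \<inter> id W \<noteq> {}"
      then obtain s where "s \<in> S" "s \<in> Z" "s \<in> W"
        by (auto simp: nT_def)
      then have "Z = W"
        using uniq[of Z W "(s, g Z)"] ZW gT[of Z] gT[of W] parts by (auto simp: leaves_def)
      with ZW show False by blast
    qed
  next
    fix t assume "t \<in> g ` I2"
    then show "finite (nT t) \<and> mT t \<le> card (nT t)"
      using mT_le gT by auto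
  qed
  finally have s2: "sum demand I2 \<le> int (sum mT Y) - int (card Q)"
    by (simp add: cQ sum_subtractf)
  have "independent S T I3"
    using I(3) parts(3) unfolding independent_def by (rule pairwise_subset)
  then obtain A B where AB: "A \<subseteq> S" "B \<subseteq> T" "\<And>e. e \<in> A \<times> B \<Longrightarrow> \<exists>Z\<in>I3. leaves e Z"
    "(\<Sum>Z\<in>I3. int l - int (rS (S - Z)) - int (rT (T \<inter> Z))) \<le>
      int l - int (rS (S - A)) - int (rT (T - B))"
    using merge_rank_demands[OF fins(3)] by blast
  have s3: "sum demand I3 \<le> int l - int (rS (S - A)) - int (rT (T - B))"
    using AB(4) h(2) by simp
  have HAB: "H \<inter> A \<times> B = {}"
  proof (rule ccontr)
    assume "H \<inter> A \<times> B \<noteq> {}"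
    then obtain s t where st: "(s, t) \<in> H" "s \<in> A" "t \<in> B"
      by blast
    then obtain Z where "Z \<in> I3" "leaves (s, t) Z"
      using AB(3)[of "(s, t)"] by blast
    then show False
      using h(1)[of Z] st AB(1,2) by (auto simp: leaves_def)
  qed
  have notP: "\<exists>Z\<in>I1. leaves (s, t) Z" if "s \<in> X" "t \<in> T" "(s, t) \<notin> H" "(s, t) \<notin> P" for s t
  proof -
    have "t \<in> U s"
      using that by (auto simp: P_def nS_def)
    then obtain Z where "Z \<in> I1" "f Z = s" "t \<notin> Z"
      by (auto simp: U_def)
    then show ?thesis
      using fS[of Z] by (auto simp: leaves_def)
  qed
  have notQ: "\<exists>Z\<in>I2. leaves (s, t) Z" if "t \<in> Y" "s \<in> S" "(s, t) \<notin> H" "(s, t) \<notin> Q" for s t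
  proof -
    have "(t, s) \<notin> (SIGMA t:Y. nT t - V t)"
      using that(4) by (force simp: Q_def)
    then have "s \<in> V t"
      using that by (auto simp: nT_def)
    then obtain Z where "Z \<in> I2" "g Z = t" "s \<in> Z"
      by (auto simp: V_def)
    then show ?thesis
      using gT[of Z] by (auto simp: leaves_def)
  qed
  have XY: "X \<times> Y - H \<subseteq> P \<union> Q"
  proof (rule ccontr)
    assume "\<not> ?thesis"
    then obtain s t where st: "s \<in> X" "t \<in> Y" "(s, t) \<notin> H" "(s, t) \<notin> P" "(s, t) \<notin> Q"
      by blast
    then have "s \<in> S" "t \<in> T"
      using XYsub by auto
    then obtain Z W where "Z \<in> I1" "W \<in> I2" "leaves (s, t) Z" "leaves (s, t) W"
      using notP notQ st by meson
    then show False
      using uniq[of Z W "(s, t)"] parts \<open>s \<in> S\<close> \<open>t \<in> T\<close> by blast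
  qed
  have PA: "(X \<inter> A) \<times> B \<subseteq> P"
  proof (rule ccontr)
    assume "\<not> ?thesis"
    then obtain s t where st: "s \<in> X" "s \<in> A" "t \<in> B" "(s, t) \<notin> P"
      by blast
    then have *: "s \<in> S" "t \<in> T" "(s, t) \<notin> H"
      using AB(1,2) HAB by auto
    then obtain Z where "Z \<in> I1" "leaves (s, t) Z"
      using notP st by meson
    moreover obtain W where "W \<in> I3" "leaves (s, t) W"
      using AB(3)[of "(s, t)"] st by blast
    ultimately show False
      using uniq[of Z W "(s, t)"] parts * by blast
  qed
  have QB: "A \<times> (Y \<inter> B) \<subseteq> Q"
  proof (rule ccontr)
    assume "\<not> ?thesis"
    then obtain s t where st: "s \<in> A" "t \<in> Y" "t \<in> B" "(s, t) \<notin> Q"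
      by blast
    then have *: "s \<in> S" "t \<in> T" "(s, t) \<notin> H"
      using AB(1,2) HAB by auto
    then obtain Z where "Z \<in> I2" "leaves (s, t) Z"
      using notQ st by meson
    moreover obtain W where "W \<in> I3" "leaves (s, t) W"
      using AB(3)[of "(s, t)"] st by blast
    ultimately show False
      using uniq[of Z W "(s, t)"] parts * by blast
  qed
  have finPQ: "finite P" "finite Q"
    using finXY by (auto simp: P_def Q_def)
  have "sum demand I = sum demand I1 + sum demand I2 + sum demand I3"
  proof -
    have "sum demand (I1 \<union> I2 \<union> I3) = sum demand (I1 \<union> I2) + sum demand I3"
      using fins parts by (intro sum.union_disjoint) auto
    also have "sum demand (I1 \<union> I2) = sum demand I1 + sum demand I2"
      using fins parts by (intro sum.union_disjoint) auto
    finally show ?thesis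
      using I_eq by simp
  qed
  then show ?thesis
    using charged_pairs_bound[OF XYsub AB(1,2) finPQ HAB XY PA QB] s1 s2 s3 by linarith
qed

section \<open>From the cover to the graph\<close>

lemma exists_covering_graph:
  "\<exists>E. set_mset E \<subseteq> S \<times> T \<and> size E \<le> \<gamma> \<and>
     (\<forall>Z\<in>demand_sets. demand Z \<le> int (size {#e \<in># E. leaves e Z#}))"
  using fin independent_demand_le crossing_supermodular_demand
  by (intro crossing_supermodular_cover) (auto simp: demand_sets_def)

text \<open>Each property is the demand on a particular set: \<open>{s}\<close> and
  \<open>S \<union> T - {t}\<close> for the degrees, \<open>{s, t}\<close> for the multiplicity of
  an edge, and \<open>(S - X) \<union> Y\<close> for a cover \<open>(X, Y)\<close>.\<close>

lemma exists_graph: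
  assumes disj: "S \<inter> T = {}" and ne: "S \<noteq> {}" "T \<noteq> {}"
  obtains E where "set_mset E \<subseteq> S \<times> T"
    and "\<And>s. s \<in> S \<Longrightarrow> size {#e \<in># E. fst e = s#} = mS s"
    and "\<And>t. t \<in> T \<Longrightarrow> size {#e \<in># E. snd e = t#} = mT t"
    and "\<And>s t. s \<in> S \<Longrightarrow> t \<in> T \<Longrightarrow> count E (s, t) \<le> of_bool ((s, t) \<notin> H)"
    and "\<And>X Y. X \<subseteq> S \<Longrightarrow> Y \<subseteq> T \<Longrightarrow> \<forall>(s, t)\<in>set_mset E \<union> H. s \<in> X \<or> t \<in> Y \<Longrightarrow> l \<le> rS X + rT Y"
proof -
  obtain E where E: "set_mset E \<subseteq> S \<times> T" "size E \<le> \<gamma>"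
    "\<And>Z. Z \<in> demand_sets \<Longrightarrow> demand Z \<le> int (size {#e \<in># E. leaves e Z#})"
    using exists_covering_graph by blast
  have cov: "v \<le> int (size {#e \<in># E. leaves e Z#})"
    if "v \<in> demands Z" "Z \<subseteq> S \<union> T" "S \<inter> Z \<noteq> {}" "\<not> T \<subseteq> Z" for v Z
  proof -
    have "Z \<in> demand_sets"
      using that unfolding demand_sets_def by blast
    then show ?thesis
      using E(3) demand_ge[OF that(1)] by fastforce
  qed
  have sumS: "(\<Sum>s\<in>S. size {#e \<in># E. fst e = s#}) \<le> sum mS S"
    using fin E(2) total by (simp add: sum_size_filter_eq order_trans[OF size_filter_mset_lesseq])
  have sumT: "(\<Sum>t\<in>T. size {#e \<in># E. snd e = t#}) \<le> sum mT T"
    using fin E(2) total by (simp add: sum_size_filter_eq order_trans[OF size_filter_mset_lesseq])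
  have "mS s \<le> size {#e \<in># E. fst e = s#}" if s: "s \<in> S" for s
  proof -
    have "nS s \<inter> {s} = {}"
      using disj s by (auto simp: nS_def)
    then have "row_demand {s} (int (mS s))"
      using s by (auto simp: row_demand_def)
    moreover have "\<not> T \<subseteq> {s}"
      using disj s ne by blast
    ultimately have "int (mS s) \<le> int (size {#e \<in># E. leaves e {s}#})"
      using s by (intro cov) (auto simp: demands_def)
    also have "\<dots> \<le> int (size {#e \<in># E. fst e = s#})"
      by (intro of_nat_mono size_mset_mono filter_mset_mono_strong) (auto simp: leaves_def)
    finally show ?thesis by simp
  qed
  then have degS: "size {#e \<in># E. fst e = s#} = mS s" if "s \<in> S" for s
    using sum_le_imp_eq[OF fin(1) _ sumS that] by blast
  have "mT t \<le> size {#e \<in># E. snd e = t#}" if t: "t \<in> T" for t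
  proof -
    let ?Z = "S \<union> T - {t}"
    have "nT t - ?Z = {}" "T - ?Z = {t}"
      using disj t by (auto simp: nT_def)
    then have "col_demand ?Z (int (mT t))"
      by (auto simp: col_demand_def)
    moreover have "S \<inter> ?Z \<noteq> {}"
      using disj t ne by blast
    ultimately have "int (mT t) \<le> int (size {#e \<in># E. leaves e ?Z#})"
      using t by (intro cov) (auto simp: demands_def)
    also have "\<dots> \<le> int (size {#e \<in># E. snd e = t#})"
      using E(1) by (intro of_nat_mono size_mset_mono filter_mset_mono_strong) (auto simp: leaves_def)
    finally show ?thesis by simp
  qed
  then have degT: "size {#e \<in># E. snd e = t#} = mT t" if "t \<in> T" for t
    using sum_le_imp_eq[OF fin(2) _ sumT that] by blast
  \<comment> \<open>Of the exactly \<open>mS s\<close> edges at \<open>s\<close>, the demand on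
    \<open>{s, t}\<close> sends all but \<open>of_bool ((s, t) \<notin> H)\<close> elsewhere. For
    \<open>T = {t}\<close> the rectangle of \<open>{s, t}\<close> is empty, and
    \<open>mS s \<le> card (nS s)\<close> gives the bound instead.\<close>
  have "count E (s, t) \<le> of_bool ((s, t) \<notin> H)" if st: "s \<in> S" "t \<in> T" for s t
  proof (cases "T = {t}")
    case True
    have "count E (s, t) = size {#e \<in># E. e = (s, t)#}"
      by (rule count_conv_size_mset)
    also have "\<dots> \<le> size {#e \<in># E. fst e = s#}"
      by (intro size_mset_mono filter_mset_mono_strong) auto
    also have "\<dots> \<le> card (nS s)"
      using degS mS_le st by simp
    also have "nS s = (if (s, t) \<in> H then {} else {t})"
      unfolding nS_def using True by auto
    finally show ?thesis
      by (simp split: if_splits)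
  next
    case False
    have "s \<notin> T" "t \<notin> S"
      using disj st by auto
    then have Z: "S \<inter> {s, t} = {s}" "\<not> T \<subseteq> {s, t}"
      and "nS s \<inter> {s, t} = (if (s, t) \<in> H then {} else {t})"
      using st False by (auto simp: nS_def)
    then have "card (nS s \<inter> {s, t}) = of_bool ((s, t) \<notin> H)"
      by simp
    then have "row_demand {s, t} (int (mS s) - of_bool ((s, t) \<notin> H))"
      using Z(1) by (auto simp: row_demand_def)
    then have "int (mS s) - of_bool ((s, t) \<notin> H) \<le> int (size {#e \<in># E. leaves e {s, t}#})"
      using Z st by (intro cov) (auto simp: demands_def)
    moreover have "size {#e \<in># E. leaves e {s, t}#} + size {#e \<in># E. e = (s, t)#} \<le>
        size {#e \<in># E. fst e = s#}"
    proof -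
      have "{#e \<in># E. leaves e {s, t} \<or> e = (s, t)#} =
          {#e \<in># E. leaves e {s, t}#} + {#e \<in># E. e = (s, t)#}"
        by (auto simp: multiset_eq_iff leaves_def)
      then have "size {#e \<in># E. leaves e {s, t}#} + size {#e \<in># E. e = (s, t)#} =
          size {#e \<in># E. leaves e {s, t} \<or> e = (s, t)#}"
        by (metis size_union)
      also have "\<dots> \<le> size {#e \<in># E. fst e = s#}"
        using E(1) \<open>t \<notin> S\<close>
        by (intro size_mset_mono filter_mset_mono_strong) (auto simp: leaves_def)
      finally show ?thesis .
    qed
    ultimately have "int (count E (s, t)) \<le> of_bool ((s, t) \<notin> H)"
      using degS[OF st(1)] count_conv_size_mset[of E "(s, t)"] by linarith
    then show ?thesis
      by (cases "(s, t) \<in> H") simp_all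
  qed
  moreover have "l \<le> rS X + rT Y"
    if XY: "X \<subseteq> S" "Y \<subseteq> T" "\<forall>(s, t)\<in>set_mset E \<union> H. s \<in> X \<or> t \<in> Y" for X Y
  proof (cases "X = S \<or> Y = T")
    case True
    then show ?thesis using rank by auto
  next
    case False
    let ?Z = "(S - X) \<union> Y"
    have Z: "S \<inter> ?Z = S - X" "T - ?Z = T - Y" "S - ?Z = X" "T \<inter> ?Z = Y"
      using XY disj by auto
    have "H \<inter> (S \<inter> ?Z) \<times> (T - ?Z) = {}"
      unfolding Z(1,2) using XY(3) by blast
    then have "rank_demand ?Z (int l - int (rS X) - int (rT Y))"
      unfolding rank_demand_def Z(3,4) by simp
    moreover have "S \<inter> ?Z \<noteq> {}" "\<not> T \<subseteq> ?Z"
      using False XY(1,2) Z(1,2) by auto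
    ultimately have "int l - int (rS X) - int (rT Y) \<le> int (size {#e \<in># E. leaves e ?Z#})"
      using XY by (intro cov) (auto simp: demands_def)
    \<comment> \<open>An edge leaving \<open>?Z\<close> would be missed by the cover, so the rank
      demand is at most 0.\<close>
    moreover have "{#e \<in># E. leaves e ?Z#} = {#}"
      using E(1) XY(3) disj XY(1,2) by (fastforce simp: leaves_def)
    ultimately show ?thesis by simp
  qed
  ultimately show thesis
    using that[OF E(1) degS degT] by blast
qed

end

section \<open>Bigraph notions in terms of sets of pairs, and necessity\<close>

lemma degree_eq:
  assumes "set_mset G \<subseteq> S \<times> T" "S \<inter> T = {}"
  shows "s \<in> S \<Longrightarrow> degree G s = size {#e \<in># G. fst e = s#}"
    and "t \<in> T \<Longrightarrow> degree G t = size {#e \<in># G. snd e = t#}"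
  unfolding degree_def using assms
  by (auto simp: ends_def intro!: arg_cong[where f = size] filter_mset_cong)

lemma edges_between_bipartite_complement:
  assumes "finite S" "finite T" "X \<subseteq> S" "Y \<subseteq> T"
  shows "edges_between (bipartite_complement S T H) X Y = card (X \<times> Y - set_mset H)"
proof -
  have "{e \<in> S \<times> T - set_mset H. fst e \<in> X \<and> snd e \<in> Y} = X \<times> Y - set_mset H"
    using assms(3,4) by auto
  then show ?thesis
    by (simp add: edges_between_def bipartite_complement_def assms(1,2))
qed

lemma hits_every_edge_iff:
  assumes "set_mset H \<subseteq> S \<times> T" "S \<inter> T = {}" "X \<subseteq> S" "Y \<subseteq> T"
  shows "hits_every_edge (X \<union> Y) H \<longleftrightarrow> set_mset H \<inter> (S - X) \<times> (T - Y) = {}"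
proof -
  have "(X \<union> Y) \<inter> ends e \<noteq> {} \<longleftrightarrow> e \<notin> (S - X) \<times> (T - Y)" if e: "e \<in># H" for e
  proof -
    obtain s t where "e = (s, t)" "s \<in> S" "t \<in> T"
      using assms(1) e by blast
    then show ?thesis
      using assms(2-4) by (auto simp: ends_def)
  qed
  then show ?thesis
    unfolding hits_every_edge_def by blast
qed

text \<open>The bases have \<open>l\<close> elements each, so the \<open>l\<close> edges of
  \<open>N\<close> have exactly \<open>BS\<close> and \<open>BT\<close> as their ends. At most
  \<open>rS X\<close> edges then meet \<open>X\<close>, since \<open>BS \<inter> X\<close> is
  independent, and at most \<open>rT Y\<close> meet \<open>Y\<close>; the others avoid both.\<close>

lemma basis_matching_avoiding:
  assumes "N \<subseteq> S \<times> T" "finite N" "card N = l" "S \<inter> T = {}"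
    and disj: "\<forall>e\<in>N. \<forall>f\<in>N. e \<noteq> f \<longrightarrow> ends e \<inter> ends f = {}"
    and mat: "matroid S rS" "matroid T rT" and rank: "rS S = l" "rT T = l"
    and basis: "matroid_basis S rS BS" "covers N BS" "matroid_basis T rT BT" "covers N BT"
    and XY: "X \<subseteq> S" "Y \<subseteq> T"
  shows "l \<le> card {e \<in> N. fst e \<notin> X \<and> snd e \<notin> Y} + rS X + rT Y"
proof -
  have inj: "inj_on fst N" "inj_on snd N"
    using disj by (force simp: inj_on_def ends_def)+
  have B: "BS \<subseteq> S" "BT \<subseteq> T" "card BS = l" "card BT = l"
    using basis(1,3) matroid_basis_card[OF mat(1) basis(1)] matroid_basis_card[OF mat(2) basis(3)]
      rank by (simp_all add: matroid_basis_def matroid_indep_def)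
  have "BS \<subseteq> fst ` N"
  proof
    fix v assume v: "v \<in> BS"
    then obtain e where e: "e \<in> N" "v \<in> ends e"
      using basis(2) by (auto simp: covers_def)
    moreover have "snd e \<in> T" "v \<in> S"
      using e v B assms(1) by auto
    ultimately show "v \<in> fst ` N"
      using assms(4) by (auto simp: ends_def)
  qed
  then have BS: "BS = fst ` N"
    using assms(2,3) B inj by (intro card_subset_eq) (auto simp: card_image)
  have "BT \<subseteq> snd ` N"
  proof
    fix v assume v: "v \<in> BT"
    then obtain e where e: "e \<in> N" "v \<in> ends e"
      using basis(4) by (auto simp: covers_def)
    moreover have "fst e \<in> S" "v \<in> T"
      using e v B assms(1) by auto
    ultimately show "v \<in> snd ` N"
      using assms(4) by (auto simp: ends_def)
  qed
  then have BT: "BT = snd ` N"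
    using assms(2,3) B inj by (intro card_subset_eq) (auto simp: card_image)
  have "card {e \<in> N. fst e \<in> X} \<le> rS X"
  proof -
    have "card {e \<in> N. fst e \<in> X} = card (fst ` {e \<in> N. fst e \<in> X})"
      using inj(1) by (intro card_image[symmetric]) (auto simp: inj_on_def)
    also have "fst ` {e \<in> N. fst e \<in> X} = BS \<inter> X"
      unfolding BS by auto
    also have "card (BS \<inter> X) = rS (BS \<inter> X)"
      using matroid_indep_subset[OF mat(1), of BS "BS \<inter> X"] basis(1)
      by (simp add: matroid_basis_def)
    also have "\<dots> \<le> rS X"
      using XY by (intro matroid_mono[OF mat(1)]) auto
    finally show ?thesis .
  qed
  moreover have "card {e \<in> N. snd e \<in> Y} \<le> rT Y"
  proof -
    have "card {e \<in> N. snd e \<in> Y} = card (snd ` {e \<in> N. snd e \<in> Y})"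
      using inj(2) by (intro card_image[symmetric]) (auto simp: inj_on_def)
    also have "snd ` {e \<in> N. snd e \<in> Y} = BT \<inter> Y"
      unfolding BT by auto
    also have "card (BT \<inter> Y) = rT (BT \<inter> Y)"
      using matroid_indep_subset[OF mat(2), of BT "BT \<inter> Y"] basis(3)
      by (simp add: matroid_basis_def)
    also have "\<dots> \<le> rT Y"
      using XY by (intro matroid_mono[OF mat(2)]) auto
    finally show ?thesis .
  qed
  moreover have "card N \<le> card {e \<in> N. fst e \<notin> X \<and> snd e \<notin> Y} +
      card {e \<in> N. fst e \<in> X} + card {e \<in> N. snd e \<in> Y}"
  proof -
    have "N = {e \<in> N. fst e \<notin> X \<and> snd e \<notin> Y} \<union> {e \<in> N. fst e \<in> X} \<union> {e \<in> N. snd e \<in> Y}"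
      by blast
    then show ?thesis
      using card_Un_le by (metis (no_types, lifting) add_le_mono1 le_trans)
  qed
  ultimately show ?thesis
    using assms(3) by linarith
qed

text \<open>The degree sum counts the edges meeting \<open>X \<union> Y\<close> once and those
  between \<open>X\<close> and \<open>Y\<close> once more. The former omit \<open>D\<close>; the
  latter are distinct pairs outside \<open>H\<close>. The empty \<open>D\<close> gives the first
  inequality of the theorem, and matching edges give the second.\<close>

lemma degree_sum_le:
  assumes fin: "finite S" "finite T" "X \<subseteq> S" "Y \<subseteq> T" and "S \<inter> T = {}"
    and G: "bigraph_on S T G" "fits S T G mS mT" "simple_bigraph (G + H)"
    and D: "finite D" "D \<subseteq> set_mset G" "\<And>e. e \<in> D \<Longrightarrow> fst e \<notin> X \<and> snd e \<notin> Y"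
    and total: "sum mS S = \<gamma>"
  shows "sum mS X + sum mT Y + card D \<le> \<gamma> + card (X \<times> Y - set_mset H)"
proof -
  have GS: "set_mset G \<subseteq> S \<times> T"
    using G(1) by (simp add: bigraph_on_def)
  have finXY: "finite X" "finite Y"
    using fin finite_subset by blast+
  have mS: "sum mS A = size {#e \<in># G. fst e \<in> A#}" if "A \<subseteq> S" for A
  proof -
    have "sum mS A = (\<Sum>s\<in>A. size {#e \<in># G. fst e = s#})"
      using G(2) degree_eq(1)[OF GS assms(5)] that by (intro sum.cong) (auto simp: fits_def)
    then show ?thesis
      using sum_size_filter_eq finite_subset[OF that fin(1)] by metis
  qed
  have mT: "sum mT Y = size {#e \<in># G. snd e \<in> Y#}"
  proof -
    have "sum mT Y = (\<Sum>t\<in>Y. size {#e \<in># G. snd e = t#})"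
      using G(2) degree_eq(2)[OF GS assms(5)] fin(4) by (intro sum.cong) (auto simp: fits_def)
    then show ?thesis
      using sum_size_filter_eq finXY(2) by metis
  qed
  have "{#e \<in># G. fst e \<in> S#} = G"
    using GS by (auto simp: filter_mset_eq_conv)
  then have \<gamma>: "\<gamma> = size G"
    using mS[of S] total by simp
  have "{#e \<in># G. fst e \<in> X#} + {#e \<in># G. snd e \<in> Y#} =
      {#e \<in># G. fst e \<in> X \<or> snd e \<in> Y#} + {#e \<in># G. fst e \<in> X \<and> snd e \<in> Y#}"
    by (auto simp: multiset_eq_iff)
  then have "sum mS X + sum mT Y =
      size {#e \<in># G. fst e \<in> X \<or> snd e \<in> Y#} + size {#e \<in># G. fst e \<in> X \<and> snd e \<in> Y#}"
    unfolding mS[OF fin(3)] mT by (metis size_union)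
  moreover have "size {#e \<in># G. fst e \<in> X \<or> snd e \<in> Y#} + card D \<le> size G"
  proof -
    have "{#e \<in># G. fst e \<in> X \<or> snd e \<in> Y#} + mset_set D \<subseteq># G"
    proof (rule mset_subset_eqI)
      fix e
      show "count ({#e \<in># G. fst e \<in> X \<or> snd e \<in> Y#} + mset_set D) e \<le> count G e"
        using D by (cases "e \<in> D") (auto simp: Suc_le_eq)
    qed
    then show ?thesis
      using size_mset_mono by fastforce
  qed
  moreover have "size {#e \<in># G. fst e \<in> X \<and> snd e \<in> Y#} \<le> card (X \<times> Y - set_mset H)"
  proof -
    have "{#e \<in># G. fst e \<in> X \<and> snd e \<in> Y#} \<subseteq># mset_set (X \<times> Y - set_mset H)"
    proof (rule mset_subset_eqI)
      fix e
      have le: "count G e + count H e \<le> 1"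
        using G(3) by (metis simple_bigraph_def count_union)
      have "count G e = 0" if "e \<in># H"
      proof -
        have "count H e > 0"
          using that by simp
        then show ?thesis
          using le by linarith
      qed
      then show "count {#e \<in># G. fst e \<in> X \<and> snd e \<in> Y#} e
          \<le> count (mset_set (X \<times> Y - set_mset H)) e"
        using finXY le by (cases "e \<in># H") (auto simp: count_mset_set' mem_Times_iff)
    qed
    then show ?thesis
      using size_mset_mono by fastforce
  qed
  ultimately show ?thesis
    using \<gamma> by linarith
qed

theorem theorem8:
  fixes S T :: "'a set"
    and H0 :: "'a bigraph"
    and rS rT :: "'a set \<Rightarrow> nat"
    and mS mT :: "'a \<Rightarrow> nat"
    and l \<gamma> :: nat
  assumes "finite S" "finite T" "S \<noteq> {}" "T \<noteq> {}" "S \<inter> T = {}"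
    and "bigraph_on S T H0" "simple_bigraph H0"
    and "matroid S rS" "matroid T rT"
    and "rS S = l" "rT T = l"
    and "sum mS S = \<gamma>" "sum mT T = \<gamma>"
  defines "G0 \<equiv> bipartite_complement S T H0"
  shows "(\<exists>G. bigraph_on S T G \<and> fits S T G mS mT \<and> simple_bigraph (G + H0) \<and>
             has_basis_matching (G + H0) S rS T rT l)
    \<longleftrightarrow>
      (\<forall>X Y. X \<subseteq> S \<and> Y \<subseteq> T \<longrightarrow>
         int (sum mS X) + int (sum mT Y) - int (edges_between G0 X Y) \<le> int \<gamma>) \<and>
      (\<forall>X X' Y Y'. X \<subseteq> X' \<and> X' \<subseteq> S \<and> Y \<subseteq> Y' \<and> Y' \<subseteq> T \<and> hits_every_edge (X' \<union> Y') H0 \<longrightarrow>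
         int (sum mS X) + int (sum mT Y) - int (edges_between G0 X Y)
           + int l - int (rS X') - int (rT Y') \<le> int \<gamma>)"
    (is "?L \<longleftrightarrow> ?R1 \<and> ?R2")
proof -
  have H: "set_mset H0 \<subseteq> S \<times> T"
    using assms(6) by (simp add: bigraph_on_def)
  have eb: "edges_between G0 X Y = card (X \<times> Y - set_mset H0)" if "X \<subseteq> S" "Y \<subseteq> T" for X Y
    using edges_between_bipartite_complement[OF assms(1,2) that] by (simp add: G0_def)
  have hits: "hits_every_edge (X' \<union> Y') H0 \<longleftrightarrow> set_mset H0 \<inter> (S - X') \<times> (T - Y') = {}"
    if "X' \<subseteq> S" "Y' \<subseteq> T" for X' Y'
    using hits_every_edge_iff[OF H assms(5) that] .
  show ?thesis
  proof (intro iffI conjI)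
    assume ?L
    then obtain G where G: "bigraph_on S T G" "fits S T G mS mT" "simple_bigraph (G + H0)"
      and "has_basis_matching (G + H0) S rS T rT l"
      by blast
    then obtain N BS BT where N: "matching_in (G + H0) N" "card N = l"
      "matroid_basis S rS BS" "covers N BS" "matroid_basis T rT BT" "covers N BT"
      unfolding has_basis_matching_def by blast
    have Nsub: "N \<subseteq> set_mset G \<union> set_mset H0"
      and Ndisj: "\<forall>e\<in>N. \<forall>f\<in>N. e \<noteq> f \<longrightarrow> ends e \<inter> ends f = {}"
      using N(1) by (simp_all add: matching_in_def)
    have NST: "N \<subseteq> S \<times> T"
      using Nsub H G(1) unfolding bigraph_on_def by blast
    have finN: "finite N"
      using Nsub finite_subset by blast
    show ?R1
    proof (intro allI impI)
      fix X Y assume XY: "X \<subseteq> S \<and> Y \<subseteq> T"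
      have "sum mS X + sum mT Y + card ({} :: ('a \<times> 'a) set) \<le> \<gamma> + card (X \<times> Y - set_mset H0)"
        using XY assms(1,2,5,12) G by (intro degree_sum_le) auto
      then show "int (sum mS X) + int (sum mT Y) - int (edges_between G0 X Y) \<le> int \<gamma>"
        using eb[of X Y] XY by (simp del: of_nat_sum)
    qed
    show ?R2
    proof (intro allI impI)
      fix X X' Y Y'
      assume *: "X \<subseteq> X' \<and> X' \<subseteq> S \<and> Y \<subseteq> Y' \<and> Y' \<subseteq> T \<and> hits_every_edge (X' \<union> Y') H0"
      then have XY: "X \<subseteq> S" "Y \<subseteq> T" "X' \<subseteq> S" "Y' \<subseteq> T"
        by auto
      \<comment> \<open>Matching edges missed by \<open>X' \<union> Y'\<close>: they cannot come
        from \<open>H0\<close>, all of whose edges are hit, so they belong to \<open>G\<close>; they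
        avoid \<open>X\<close> and \<open>Y\<close> because these are subsets of \<open>X'\<close>
        and \<open>Y'\<close>.\<close>
      define D where "D = {e \<in> N. fst e \<notin> X' \<and> snd e \<notin> Y'}"
      have "l \<le> card D + rS X' + rT Y'"
        unfolding D_def
        using basis_matching_avoiding[OF NST finN N(2) assms(5) Ndisj assms(8-11) N(3-6) XY(3,4)] .
      moreover have "D \<subseteq> set_mset G"
      proof
        fix e assume e: "e \<in> D"
        then have "e \<in> (S - X') \<times> (T - Y')"
          using NST by (auto simp: D_def)
        then have "e \<notin># H0"
          using hits[OF XY(3,4)] * by blast
        then show "e \<in># G"
          using e Nsub by (auto simp: D_def)
      qed
      then have "sum mS X + sum mT Y + card D \<le> \<gamma> + card (X \<times> Y - set_mset H0)"
        using * XY assms(1,2,5,12) G finN by (intro degree_sum_le) (auto simp: D_def)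
      ultimately show "int (sum mS X) + int (sum mT Y) - int (edges_between G0 X Y)
           + int l - int (rS X') - int (rT Y') \<le> int \<gamma>"
        using eb[OF XY(1,2)] by linarith
    qed
  next
    assume R: "?R1 \<and> ?R2"
    interpret matroidal_degree_spec S T "set_mset H0" rS rT mS mT l \<gamma>
    proof
      fix X Y assume XY: "X \<subseteq> S" "Y \<subseteq> T"
      then have "int (sum mS X) + int (sum mT Y) - int (edges_between G0 X Y) \<le> int \<gamma>"
        using R by blast
      then show "sum mS X + sum mT Y \<le> \<gamma> + card (X \<times> Y - set_mset H0)"
        using eb[OF XY] by linarith
    next
      fix X X' Y Y'
      assume *: "X \<subseteq> X'" "X' \<subseteq> S" "Y \<subseteq> Y'" "Y' \<subseteq> T" "set_mset H0 \<inter> (S - X') \<times> (T - Y') = {}"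
      then have "int (sum mS X) + int (sum mT Y) - int (edges_between G0 X Y)
           + int l - int (rS X') - int (rT Y') \<le> int \<gamma>"
        using R hits[of X' Y'] by blast
      moreover have "edges_between G0 X Y = card (X \<times> Y - set_mset H0)"
        using * by (intro eb) auto
      ultimately show "sum mS X + sum mT Y + l \<le>
          \<gamma> + card (X \<times> Y - set_mset H0) + rS X' + rT Y'"
        by linarith
    qed (fact assms(1,2,8-13))+
    obtain E where E: "set_mset E \<subseteq> S \<times> T"
      and deg: "\<And>s. s \<in> S \<Longrightarrow> size {#e \<in># E. fst e = s#} = mS s"
        "\<And>t. t \<in> T \<Longrightarrow> size {#e \<in># E. snd e = t#} = mT t"
      and count: "\<And>s t. s \<in> S \<Longrightarrow> t \<in> T \<Longrightarrow> count E (s, t) \<le> of_bool ((s, t) \<notin># H0)"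
      and cover: "\<And>X Y. X \<subseteq> S \<Longrightarrow> Y \<subseteq> T \<Longrightarrow>
        \<forall>(s, t)\<in>set_mset E \<union> set_mset H0. s \<in> X \<or> t \<in> Y \<Longrightarrow> l \<le> rS X + rT Y"
      by (fact exists_graph[OF assms(5,3,4)])
    have fits: "fits S T E mS mT"
      using deg degree_eq[OF E assms(5)] by (simp add: fits_def)
    have "count E e + count H0 e \<le> 1" for e
    proof (cases "e \<in> S \<times> T")
      case True
      have "count H0 e \<le> 1"
        using assms(7) unfolding simple_bigraph_def by blast
      then show ?thesis
        using count[of "fst e" "snd e"] True by (cases "e \<in># H0") (auto simp: not_in_iff)
    next
      case False
      then have "e \<notin># E" "e \<notin># H0"
        using E H by auto
      then show ?thesis
        by (simp add: not_in_iff)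
    qed
    then have simple: "simple_bigraph (E + H0)"
      by (simp add: simple_bigraph_def)
    have sub: "set_mset E \<union> set_mset H0 \<subseteq> S \<times> T"
      using E H by blast
    have "finite (set_mset E \<union> set_mset H0)"
      by simp
    from matroidal_koenig[OF this sub assms(8,9) cover]
    obtain N where N: "N \<subseteq> set_mset E \<union> set_mset H0" "card N = l" "inj_on fst N" "inj_on snd N"
      "rS (fst ` N) = l" "rT (snd ` N) = l"
      by blast
    have NST: "N \<subseteq> S \<times> T"
      using N(1) sub by blast
    have "matching_in (E + H0) N"
      unfolding matching_in_def
    proof (intro conjI ballI impI)
      fix e f assume ef: "e \<in> N" "f \<in> N" "e \<noteq> f"
      then have "fst e \<noteq> fst f" "snd e \<noteq> snd f"
        using N(3,4) by (auto dest: inj_onD)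
      moreover have "fst e \<in> S" "fst f \<in> S" "snd e \<in> T" "snd f \<in> T"
        using ef NST by auto
      ultimately show "ends e \<inter> ends f = {}"
        using assms(5) by (auto simp: ends_def)
    qed (use N(1) in auto)
    moreover have "matroid_basis S rS (fst ` N)"
      using N NST assms(8,10) by (intro matroid_basisI) (auto simp: card_image)
    moreover have "matroid_basis T rT (snd ` N)"
      using N NST assms(9,11) by (intro matroid_basisI) (auto simp: card_image)
    moreover have "covers N (fst ` N)" "covers N (snd ` N)"
      by (auto simp: covers_def ends_def)
    ultimately have "has_basis_matching (E + H0) S rS T rT l"
      unfolding has_basis_matching_def using N(2) by blast
    moreover have "bigraph_on S T E"
      using E assms(1,2,5) by (simp add: bigraph_on_def)
    ultimately show ?L
      using fits simple by blast
  qed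
qed

end
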